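(* Let $G$ be a bridgeless mixed equal-partition bipartite graph of order $n$ with maximum undirected degree $\Delta^*=\max\{d_G^*(v):v\in V(G)\}$. Then (1) $\overrightarrow{\mathrm{diam}}(G)\le n-2\Delta^*+7$ if $G$ is undirected (i.e. has no directed edges); (2) $\overrightarrow{\mathrm{diam}}(G)\le n-2\Delta^*+8$ if $G$ has a vertex $u$ with $d_G^*(u)=\Delta^*$ and $d_G^+(u)+d_G^-(u)\ge 2$; (3) $\overrightarrow{\mathrm{diam}}(G)\le n-2\Delta^*+10$ otherwise.
   Context: A mixed graph $G$ is a finite graph whose edge set may contain both undirected edges $xy$ and directed edges $\overrightarrow{xy}$; its underlying graph (forgetting directions) is assumed simple, so between two vertices there is at most one edge, directed or undirected. $G$ is a mixed bipartite graph with partite sets $A,B$ if $V(G)$ is the disjoint union of $A$ and $B$ and every edge (directed or not) joins a vertex of $A$ and a vertex of $B$; it is equal-partition if $|A|=|B|$. For a vertex $x$: $d_G^+(x)$ is the number of directed edges leaving $x$, $d_G^-(x)$ the number of directed edges entering $x$, and $d_G^*(x)$ the number of undirected edges incident with $x$. An orientable path from $x_1$ to $x_k$ is a sequence of distinct vertices $x_1,\dots,x_k$ such that for each $1\le i\le k-1$ either $x_ix_{i+1}$ is an undirected edge or $\overrightarrow{x_ix_{i+1}}$ is a directed edge of $G$. $G$ is connected if for any two vertices $x,y$ there are an orientable path from $x$ to $y$ and one from $y$ to $x$. A bridge is an undirected edge whose deletion disconnects the underlying undirected graph. $G$ is bridgeless if it is connected and has no bridge. An orientation of $G$ assigns a direction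 to every undirected edge (directed edges keep their direction); it is strong if the resulting directed graph is strongly connected. The distance from $x$ to $y$ in a directed graph is the number of edges of a shortest directed path from $x$ to $y$, and the diameter is the maximum of these distances over all ordered pairs of vertices. The oriented diameter is $\overrightarrow{\mathrm{diam}}(G)=\min\{\mathrm{diam}(\overrightarrow{G}):\overrightarrow{G}\text{ is a strong orientation of }G\}$. *)

theory Defs
  imports "Graph_Theory.Graph_Theory" "HOL-Library.Extended_Nat"
begin

record 'a mixed_graph =
  mverts :: "'a set"
  medges :: "'a set set"
  marcs :: "'a rel"

locale mixed_graph =
  fixes G :: "'a mixed_graph"
  assumes finite_mverts: "finite (mverts G)"
    and mverts_nonempty: "mverts G \<noteq> {}"
    and medges_wf: "e \<in> medges G \<Longrightarrow> \<exists>x\<in>mverts G. \<exists>y\<in>mverts G. x \<noteq> y \<and> e = {x, y}"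
    and marcs_wf: "(x, y) \<in> marcs G \<Longrightarrow> x \<in> mverts G \<and> y \<in> mverts G \<and> x \<noteq> y"
    and marcs_simple: "(x, y) \<in> marcs G \<Longrightarrow> (y, x) \<notin> marcs G \<and> {x, y} \<notin> medges G"

definition mixed_bipartite :: "'a mixed_graph \<Rightarrow> 'a set \<Rightarrow> 'a set \<Rightarrow> bool" where
  "mixed_bipartite G A B \<longleftrightarrow>
     A \<inter> B = {} \<and> A \<union> B = mverts G \<and>
     (\<forall>e\<in>medges G. \<exists>a\<in>A. \<exists>b\<in>B. e = {a, b}) \<and>
     marcs G \<subseteq> A \<times> B \<union> B \<times> A"

definition equal_partition_bipartite :: "'a mixed_graph \<Rightarrow> bool" where
  "equal_partition_bipartite G \<longleftrightarrow> (\<exists>A B. mixed_bipartite G A B \<and> card A = card B)"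

definition arc_out_degree :: "'a mixed_graph \<Rightarrow> 'a \<Rightarrow> nat" where
  "arc_out_degree G x = card {a \<in> marcs G. fst a = x}"

definition arc_in_degree :: "'a mixed_graph \<Rightarrow> 'a \<Rightarrow> nat" where
  "arc_in_degree G x = card {a \<in> marcs G. snd a = x}"

definition undirected_degree :: "'a mixed_graph \<Rightarrow> 'a \<Rightarrow> nat" where
  "undirected_degree G x = card {e \<in> medges G. x \<in> e}"

definition max_undirected_degree :: "'a mixed_graph \<Rightarrow> nat" where
  "max_undirected_degree G = Max (undirected_degree G ` mverts G)"

text \<open>A path is given by its list of vertices; the one-vertex path is allowed.\<close>

definition orientable_path :: "'a mixed_graph \<Rightarrow> 'a \<Rightarrow> 'a list \<Rightarrow> 'a \<Rightarrow> bool" where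
  "orientable_path G x p y \<longleftrightarrow>
     p \<noteq> [] \<and> hd p = x \<and> last p = y \<and> distinct p \<and> set p \<subseteq> mverts G \<and>
     successively (\<lambda>u v. {u, v} \<in> medges G \<or> (u, v) \<in> marcs G) p"

definition mixed_connected :: "'a mixed_graph \<Rightarrow> bool" where
  "mixed_connected G \<longleftrightarrow>
     (\<forall>x\<in>mverts G. \<forall>y\<in>mverts G.
        (\<exists>p. orientable_path G x p y) \<and> (\<exists>p. orientable_path G y p x))"

text \<open>The underlying undirected graph, represented by a symmetric digraph.\<close>

definition underlying :: "'a mixed_graph \<Rightarrow> 'a pair_pre_digraph" where
  "underlying G =
     \<lparr> pverts = mverts G,
       parcs = {(x, y). {x, y} \<in> medges G \<or> (x, y) \<in> marcs G \<or> (y, x) \<in> marcs G} \<rparr>"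

definition bridge :: "'a mixed_graph \<Rightarrow> 'a set \<Rightarrow> bool" where
  "bridge G e \<longleftrightarrow>
     e \<in> medges G \<and> connected (with_proj (underlying G)) \<and>
     \<not> connected (with_proj (underlying (G\<lparr>medges := medges G - {e}\<rparr>)))"

definition bridgeless :: "'a mixed_graph \<Rightarrow> bool" where
  "bridgeless G \<longleftrightarrow> mixed_connected G \<and> \<not> (\<exists>e. bridge G e)"

definition orientation :: "'a mixed_graph \<Rightarrow> 'a pair_pre_digraph \<Rightarrow> bool" where
  "orientation G H \<longleftrightarrow>
     pverts H = mverts G \<and>
     marcs G \<subseteq> parcs H \<and>
     parcs H \<subseteq> marcs G \<union> {(x, y). {x, y} \<in> medges G} \<and>
     (\<forall>x y. {x, y} \<in> medges G \<longrightarrow> ((x, y) \<in> parcs H \<longleftrightarrow> (y, x) \<notin> parcs H))"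

definition strong_orientation :: "'a mixed_graph \<Rightarrow> 'a pair_pre_digraph \<Rightarrow> bool" where
  "strong_orientation G H \<longleftrightarrow> orientation G H \<and> strongly_connected (with_proj H)"

text \<open>
  Distances and diameters take values in \<^typ>\<open>enat\<close>. On nonempty sets, \<open>INF\<close> in \<^typ>\<open>enat\<close> is
  attained, and so is \<open>SUP\<close> over the finitely many pairs of vertices of a finite digraph, so these
  are the usual minima and maxima. The distance is \<open>\<infinity>\<close> if there is no path, and the oriented
  diameter is \<open>\<infinity>\<close> if there is no strong orientation; in particular, a finite bound on the oriented
  diameter entails the existence of a strong orientation.
\<close>

definition digraph_dist :: "'a pair_pre_digraph \<Rightarrow> 'a \<Rightarrow> 'a \<Rightarrow> enat" where
  "digraph_dist H x y = (INF p\<in>{p. pre_digraph.apath (with_proj H) x p y}. enat (length p))"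

definition digraph_diam :: "'a pair_pre_digraph \<Rightarrow> enat" where
  "digraph_diam H = (SUP (x, y)\<in>pverts H \<times> pverts H. digraph_dist H x y)"

definition oriented_diam :: "'a mixed_graph \<Rightarrow> enat" where
  "oriented_diam G = (INF H\<in>{H. strong_orientation G H}. digraph_diam H)"

end

theory Submission
  imports Defs
begin

text \<open>
  Let \<open>s\<close> be a vertex of maximum undirected degree, in the partite set \<open>B\<close>, and let
  \<open>N \<subseteq> A\<close> be its undirected neighbours. Paths alternate between \<open>A\<close> and \<open>B\<close>, so a path that
  meets \<open>N\<close> in at most \<open>k\<close> vertices has at most \<open>card A - \<Delta> + k\<close> vertices in \<open>A\<close>, and its
  length is at most twice that number. It suffices to find a strong orientation in which any two
  vertices are joined, via \<open>s\<close>, inside a vertex set that contains few elements of \<open>N\<close>.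

  In the mixed case, start from any strong orientation \<open>D\<close> (Boesch and Tindell) and only redirect
  the edges at \<open>s\<close>: a set \<open>M \<subseteq> N\<close> points to \<open>s\<close>, and \<open>s\<close> points to \<open>N - M\<close>. On the digraph on
  \<open>N\<close> of \<open>N\<close>-free connections, a maximal choice of \<open>M\<close> makes every vertex of \<open>N - M\<close>
  reach \<open>M\<close> in at most two steps and every vertex of \<open>M\<close> have a predecessor outside \<open>M\<close>, up to
  shortcuts along the arcs at \<open>s\<close>. So three
  vertices of \<open>N\<close> suffice to reach \<open>s\<close> and two to come from \<open>s\<close>; with two further neighbours of
  \<open>s\<close>, a path that needs all five misses one of them.

  In the undirected case, fix \<open>P \<subseteq> N\<close> before orienting, let \<open>s\<close> point to \<open>P\<close> and \<open>N - P\<close> point to \<open>s\<close>,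
  and direct the edges between \<open>N\<close> and those components of \<open>G - N - s\<close> that touch both sides from
  \<open>P\<close> through the component to \<open>N - P\<close>. The result is still strongly connected and bridgeless, and in
  any strong orientation of it two vertices of \<open>N\<close> suffice in each direction. A suitable \<open>P\<close> gains
  one more vertex of \<open>A\<close> for pairs in \<open>B\<close>.
\<close>

section \<open>Strong orientations of bridgeless mixed graphs\<close>

text \<open>If both arcs were indispensable, \<open>(x, y)\<close> would be the only arc leaving
  \<open>X\<close> and \<open>(y, x)\<close> the only arc entering \<open>Y\<close>. Any other edge
  across the border of \<open>X\<close> then has an end in a dead end, \<open>X - Y\<close> or
  \<open>Y - X\<close>.\<close>

lemma strong_minus_one_direction:
  fixes R :: "'a rel"
  assumes strong: "\<And>a b. a \<in> V \<Longrightarrow> b \<in> V \<Longrightarrow> (a, b) \<in> R\<^sup>*"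
    and RV: "R \<subseteq> V \<times> V"
    and xy: "(x, y) \<in> R" "(y, x) \<in> R"
    and nb: "(x, y) \<in> ((R \<union> R\<inverse>) - {(x, y), (y, x)})\<^sup>*"
  shows "(x, y) \<in> (R - {(x, y)})\<^sup>* \<or> (y, x) \<in> (R - {(y, x)})\<^sup>*"
proof (rule ccontr)
  assume "\<not> ?thesis"
  then have n1: "(x, y) \<notin> (R - {(x, y)})\<^sup>*" and n2: "(y, x) \<notin> (R - {(y, x)})\<^sup>*" by auto
  define X where "X = {c. (x, c) \<in> (R - {(x, y)})\<^sup>*}"
  define Y where "Y = {c. (c, x) \<in> (R - {(y, x)})\<^sup>*}"
  have mem: "x \<in> X" "x \<in> Y" "y \<notin> X" "y \<notin> Y"
    using n1 n2 by (auto simp: X_def Y_def)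
  have Xout: "d \<in> X \<or> (c, d) = (x, y)" if "(c, d) \<in> R" "c \<in> X" for c d
    using that unfolding X_def by (auto intro: rtrancl_into_rtrancl)
  have Yin: "c \<in> Y \<or> (c, d) = (y, x)" if "(c, d) \<in> R" "d \<in> Y" for c d
    using that unfolding Y_def by (auto intro: converse_rtrancl_into_rtrancl)
  have xV: "x \<in> V" using xy RV by auto
  obtain a b where ab: "a \<in> X" "b \<notin> X" "(a, b) \<in> (R \<union> R\<inverse>) - {(x, y), (y, x)}"
  proof -
    define E where "E = (R \<union> R\<inverse>) - {(x, y), (y, x)}"
    have "(x, y) \<in> E\<^sup>*" using nb by (simp add: E_def)
    then have "y \<in> X \<or> (\<exists>a b. a \<in> X \<and> b \<notin> X \<and> (a, b) \<in> E)"
      by (induction rule: rtrancl_induct) (use mem in auto)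
    then show ?thesis using that mem by (auto simp: E_def)
  qed
  then have ba: "(b, a) \<in> R" "(b, a) \<noteq> (y, x)" using Xout by auto
  \<comment> \<open>No arc leaves \<open>X - Y\<close>: the exit from \<open>X\<close> starts at
    \<open>x \<in> Y\<close>, and the entry to \<open>Y\<close> starts at
    \<open>y \<notin> X\<close>. So \<open>a\<close> outside \<open>Y\<close> could never reach
    \<open>x\<close>.\<close>
  have "a \<in> Y"
  proof (rule ccontr)
    assume "a \<notin> Y"
    have "(a, x) \<in> R\<^sup>*" using strong ba RV xV by auto
    then have "x \<in> X \<and> x \<notin> Y"
    proof (induction rule: rtrancl_induct)
      case base
      then show ?case using ab \<open>a \<notin> Y\<close> by auto
    next
      case (step c d)
      then show ?case using Xout[of c d] Yin[of c d] mem by auto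
    qed
    then show False using mem by auto
  qed
  then have "b \<in> Y" using Yin ba by blast
  \<comment> \<open>Dually, no arc enters \<open>Y - X\<close> from outside, so \<open>b\<close>
    would be unreachable from \<open>x\<close>.\<close>
  have "(x, b) \<in> R\<^sup>*" using strong ba RV xV by auto
  then have "x \<in> Y \<and> x \<notin> X"
  proof (induction rule: converse_rtrancl_induct)
    case base
    then show ?case using ab \<open>b \<in> Y\<close> by auto
  next
    case (step c d)
    then show ?case using Xout[of c d] Yin[of c d] mem by auto
  qed
  then show False using mem by auto
qed

lemma rtrancl_subset_rtranclI: "(x, y) \<in> R\<^sup>* \<Longrightarrow> R \<subseteq> S\<^sup>* \<Longrightarrow> (x, y) \<in> S\<^sup>*"
  using rtrancl_subset_rtrancl by blast

text \<open>Induction on the number of arcs whose reverse is present. Deleting one direction leaves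
  \<open>R \<union> R\<inverse>\<close> unchanged, so the last hypothesis (no two-way edge is a
  bridge) survives each step.\<close>

theorem strong_orientation_exists:
  fixes R :: "'a rel"
  assumes "finite R"
    and "\<And>a b. a \<in> V \<Longrightarrow> b \<in> V \<Longrightarrow> (a, b) \<in> R\<^sup>*"
    and "R \<subseteq> V \<times> V"
    and "irrefl R"
    and "\<And>x y. (x, y) \<in> R \<Longrightarrow> (y, x) \<in> R \<Longrightarrow> (x, y) \<in> ((R \<union> R\<inverse>) - {(x, y), (y, x)})\<^sup>*"
  shows "\<exists>D\<subseteq>R. R \<subseteq> D \<union> D\<inverse> \<and> D \<inter> D\<inverse> = {} \<and> (\<forall>a\<in>V. \<forall>b\<in>V. (a, b) \<in> D\<^sup>*)"
  using assms
proof (induction "card (R \<inter> R\<inverse>)" arbitrary: R rule: less_induct)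
  case less
  note strong = less.prems(2)
  show ?case
  proof (cases "R \<inter> R\<inverse> = {}")
    case True
    then show ?thesis using strong by (intro exI[of _ R]) auto
  next
    case False
    then obtain u v where uv: "(u, v) \<in> R" "(v, u) \<in> R" by auto
    have "(u, v) \<in> (R - {(u, v)})\<^sup>* \<or> (v, u) \<in> (R - {(v, u)})\<^sup>*"
      by (rule strong_minus_one_direction[OF strong less.prems(3) uv less.prems(5)[OF uv]])
    then obtain x y where xy: "(x, y) \<in> R" "(y, x) \<in> R" "(x, y) \<in> (R - {(x, y)})\<^sup>*"
      using uv by (elim disjE) auto
    define S where "S = R - {(x, y)}"
    have "x \<noteq> y" using xy(1) less.prems(4) by (auto simp: irrefl_def)
    then have und: "S \<union> S\<inverse> = R \<union> R\<inverse>" using xy by (auto simp: S_def)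
    have "S \<inter> S\<inverse> \<subset> R \<inter> R\<inverse>" using xy by (auto simp: S_def)
    then have "card (S \<inter> S\<inverse>) < card (R \<inter> R\<inverse>)"
      using less.prems(1) by (intro psubset_card_mono) auto
    moreover have "(a, b) \<in> S\<^sup>*" if "a \<in> V" "b \<in> V" for a b
    proof (rule rtrancl_subset_rtranclI[OF strong[OF that]])
      show "R \<subseteq> S\<^sup>*" using xy(3) by (auto simp: S_def)
    qed
    moreover have "finite S" "S \<subseteq> V \<times> V" "irrefl S"
      using less.prems by (auto simp: S_def irrefl_def)
    moreover have "(a, b) \<in> ((S \<union> S\<inverse>) - {(a, b), (b, a)})\<^sup>*" if "(a, b) \<in> S" "(b, a) \<in> S" for a b
      unfolding und using less.prems(5) that by (auto simp: S_def)
    ultimately obtain D where "D \<subseteq> S" "S \<subseteq> D \<union> D\<inverse>" "D \<inter> D\<inverse> = {}"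
        "\<forall>a\<in>V. \<forall>b\<in>V. (a, b) \<in> D\<^sup>*"
      using less.hyps[of S] by auto
    then show ?thesis using und by (intro exI[of _ D]) (auto simp: S_def)
  qed
qed

section \<open>Reachability inside a vertex set\<close>

text \<open>\<open>rtrancl_on W D\<close> confines all vertices of a walk to \<open>W\<close>. The
  second alternative cuts the walk at its first vertex outside \<open>X\<close>.\<close>

lemma rtrancl_on_exit:
  assumes "(x, y) \<in> rtrancl_on W D" and "x \<in> X"
  shows "(x, y) \<in> rtrancl_on (W \<inter> X) D \<or>
    (\<exists>a b. (x, a) \<in> rtrancl_on (W \<inter> X) D \<and> (a, b) \<in> D \<and> b \<in> W - X)"
  using assms
proof (induction rule: rtrancl_on_induct)
  case base
  then show ?case by auto
next
  case (step c d)
  show ?case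
  proof (cases "(x, c) \<in> rtrancl_on (W \<inter> X) D")
    case xc: True
    then have "c \<in> X" using in_rtrancl_on_in_F(2) by fastforce
    show ?thesis
    proof (cases "d \<in> X")
      case True
      then have "(x, d) \<in> rtrancl_on (W \<inter> X) D"
        using xc step \<open>c \<in> X\<close> by (auto intro: rtrancl_on_into_rtrancl_on)
      then show ?thesis ..
    next
      case False
      then show ?thesis using xc step by blast
    qed
  next
    case False
    then show ?thesis using step by blast
  qed
qed

lemma rtrancl_on_avoid:
  assumes "(x, y) \<in> rtrancl_on W D"
  shows "(x, y) \<in> rtrancl_on (W - {t}) D \<or>
    (x, t) \<in> rtrancl_on W D \<and> (t, y) \<in> rtrancl_on W D"
  using assms
proof (induction rule: rtrancl_on_induct)
  case base
  then show ?case by (cases "x = t") auto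
next
  case (step c d)
  show ?case
  proof (cases "(x, c) \<in> rtrancl_on (W - {t}) D \<and> d \<noteq> t")
    case True
    then have "(x, d) \<in> rtrancl_on (W - {t}) D"
      using step in_rtrancl_on_in_F(2)[of x c "W - {t}" D]
      by (auto intro: rtrancl_on_into_rtrancl_on)
    then show ?thesis ..
  next
    case False
    have xd: "(x, d) \<in> rtrancl_on W D" and dd: "(d, d) \<in> rtrancl_on W D"
      using step.hyps by (auto intro: rtrancl_on_into_rtrancl_on)
    show ?thesis
    proof (cases "d = t")
      case True
      then show ?thesis using xd dd by simp
    next
      case False
      then have "(x, t) \<in> rtrancl_on W D" "(t, c) \<in> rtrancl_on W D"
        using step.IH \<open>\<not> (_ \<and> _)\<close> by auto
      moreover have "(t, d) \<in> rtrancl_on W D"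
        using calculation(2) step.hyps by (auto intro: rtrancl_on_into_rtrancl_on)
      ultimately show ?thesis by simp
    qed
  qed
qed

lemma rtrancl_on_converse: "(x, y) \<in> rtrancl_on W (D\<inverse>) \<longleftrightarrow> (y, x) \<in> rtrancl_on W D"
  using rtrancl_on_converseI[of x y W "D\<inverse>"] rtrancl_on_converseI[of y x W D] by auto

lemma rtrancl_imp_rtrancl_on:
  assumes "(x, y) \<in> D\<^sup>*" "x \<in> V" "y \<in> V" "D \<subseteq> V \<times> V"
  shows "(x, y) \<in> rtrancl_on V D"
  using assms by (intro rtrancl_consistent_rtrancl_on) auto

lemma rtrancl_on_subset:
  assumes "(x, y) \<in> rtrancl_on W D" "W \<subseteq> W'"
    and "\<And>a b. a \<in> W \<Longrightarrow> b \<in> W \<Longrightarrow> (a, b) \<in> D \<Longrightarrow> (a, b) \<in> D'"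
  shows "(x, y) \<in> rtrancl_on W' D'"
  using assms(1)
proof (induction rule: rtrancl_on_induct)
  case base
  then show ?case using assms(2) by auto
next
  case (step a b)
  then show ?case
    using assms(2,3) by (auto intro: rtrancl_on_into_rtrancl_on)
qed

lemma rtrancl_on_snoc:
  "(x, a) \<in> rtrancl_on W D \<Longrightarrow> (a, b) \<in> D \<Longrightarrow> W \<subseteq> W' \<Longrightarrow> b \<in> W' \<Longrightarrow> (x, b) \<in> rtrancl_on W' D"
  by (rule rtrancl_on_into_rtrancl_on[OF rtrancl_on_mono[OF subset_refl]]) auto

lemma rtrancl_on_Cons:
  "(a, b) \<in> D \<Longrightarrow> (b, y) \<in> rtrancl_on W D \<Longrightarrow> W \<subseteq> W' \<Longrightarrow> a \<in> W' \<Longrightarrow> (a, y) \<in> rtrancl_on W' D"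
  by (rule converse_rtrancl_on_into_rtrancl_on[OF _ rtrancl_on_mono[OF subset_refl]])

lemma rtrancl_on_join:
  "(x, a) \<in> rtrancl_on W1 D \<Longrightarrow> (a, y) \<in> rtrancl_on W2 D \<Longrightarrow> W1 \<union> W2 \<subseteq> W \<Longrightarrow>
    (x, y) \<in> rtrancl_on W D"
  by (rule rtrancl_on_trans[OF rtrancl_on_mono[OF subset_refl] rtrancl_on_mono[OF subset_refl]]) auto

lemma rtrancl_on_exitE:
  assumes "(x, y) \<in> rtrancl_on W D" and "x \<in> X" and "y \<notin> X"
  obtains a b where "(x, a) \<in> rtrancl_on (W \<inter> X) D" "(a, b) \<in> D" "b \<in> W - X"
proof -
  have "(x, y) \<notin> rtrancl_on (W \<inter> X) D"
    using in_rtrancl_on_in_F(2)[of x y "W \<inter> X" D] assms(3) by auto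
  with rtrancl_on_exit[OF assms(1,2)] show ?thesis using that by blast
qed

text \<open>Unlike in \<open>rtrancl_on_avoid\<close>, each half misses the opposite end. When
  \<open>x\<close> and \<open>y\<close> are the only vertices of \<open>N\<close> in
  \<open>W\<close>, each half therefore meets \<open>N\<close> in its own end alone.\<close>

lemma rtrancl_on_detour:
  assumes xy: "(x, y) \<in> rtrancl_on W D" and neq: "x \<noteq> y" "x \<noteq> t" "y \<noteq> t"
  shows "(x, y) \<in> rtrancl_on (W - {t}) D \<or>
    (x, t) \<in> rtrancl_on (W - {y}) D \<and> (t, y) \<in> rtrancl_on (W - {x}) D"
proof -
  \<comment> \<open>Stop at the first visit to \<open>{t, v}\<close>: if it is \<open>v\<close>, the
    walk missed \<open>t\<close>; otherwise it reached \<open>t\<close> without \<open>v\<close>.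
    This is applied to \<open>D\<close> and to its converse.\<close>
  have half: "(u, v) \<in> rtrancl_on (W - {t}) E \<or> (u, t) \<in> rtrancl_on (W - {v}) E"
    if h: "(u, v) \<in> rtrancl_on W E" "u \<noteq> v" "u \<noteq> t" "v \<noteq> t" for u v and E :: "'a rel"
  proof -
    obtain a b where
      ab: "(u, a) \<in> rtrancl_on (W \<inter> - {t, v}) E" "(a, b) \<in> E" "b \<in> W - - {t, v}"
      by (rule rtrancl_on_exitE[OF h(1), of "- {t, v}"]) (use h in auto)
    show ?thesis
    proof (cases "b = t")
      case True
      then show ?thesis using ab h by (intro disjI2 rtrancl_on_snoc[OF ab(1)]) auto
    next
      case False
      then have "b = v" using ab(3) by auto
      then show ?thesis using ab h by (intro disjI1 rtrancl_on_snoc[OF ab(1)]) auto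
    qed
  qed
  have "(x, y) \<in> rtrancl_on (W - {t}) D \<or> (x, t) \<in> rtrancl_on (W - {y}) D"
    using half[OF xy] neq by blast
  moreover have "(y, x) \<in> rtrancl_on (W - {t}) (D\<inverse>) \<or> (y, t) \<in> rtrancl_on (W - {x}) (D\<inverse>)"
    using half[of y x "D\<inverse>"] neq xy by (simp add: rtrancl_on_converse)
  ultimately show ?thesis by (auto simp: rtrancl_on_converse)
qed

lemma rtrancl_on_avoid_two:
  assumes "(x, y) \<in> rtrancl_on W D"
  shows "(x, y) \<in> rtrancl_on (W - {t, t'}) D \<or>
    (\<exists>z\<in>{t, t'}. (x, z) \<in> rtrancl_on W D \<and> (z, y) \<in> rtrancl_on W D)"
proof -
  have mono: "rtrancl_on (W - {t}) D \<subseteq> rtrancl_on W D"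
    using rtrancl_on_mono[of D D "W - {t}" W] by auto
  have eq: "W - {t, t'} = W - {t} - {t'}" by auto
  from rtrancl_on_avoid[OF assms, of t] show ?thesis
  proof
    assume "(x, y) \<in> rtrancl_on (W - {t}) D"
    from rtrancl_on_avoid[OF this, of t'] show ?thesis
      unfolding eq using mono by blast
  qed auto
qed

lemma rtrancl_on_detour_two:
  assumes "(x, y) \<in> rtrancl_on W D" "x \<noteq> y" "{x, y} \<inter> {t, t'} = {}"
  shows "(x, y) \<in> rtrancl_on (W - {t, t'}) D \<or>
    (\<exists>z\<in>{t, t'}. (x, z) \<in> rtrancl_on (W - {y}) D \<and> (z, y) \<in> rtrancl_on (W - {x}) D)"
proof -
  have mono: "rtrancl_on (W - {t} - {u}) D \<subseteq> rtrancl_on (W - {u}) D" for u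
    using rtrancl_on_mono[of D D "W - {t} - {u}" "W - {u}"] by auto
  have neq: "x \<noteq> t" "y \<noteq> t" "x \<noteq> t'" "y \<noteq> t'" using assms(3) by auto
  have eq: "W - {t, t'} = W - {t} - {t'}" by auto
  from rtrancl_on_detour[OF assms(1,2) neq(1,2)] show ?thesis
  proof
    assume "(x, y) \<in> rtrancl_on (W - {t}) D"
    from rtrancl_on_detour[OF this assms(2) neq(3,4)] show ?thesis
      unfolding eq using mono by blast
  qed auto
qed

section \<open>Redirecting the edges at one vertex\<close>

text \<open>
  Here \<open>F\<close> is the digraph of \<open>N\<close>-free connections, and \<open>Ifr\<close> and \<open>Out\<close> mark the vertices with
  an \<open>N\<close>-free connection from and to \<open>s\<close> along the fixed arcs at \<open>s\<close>. A set \<open>M\<close> that contains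
  the sinks of \<open>F\<close> outside \<open>Out\<close> and is maximal subject to the first conjunct also satisfies the second.
\<close>

lemma colouring_exists:
  fixes F :: "'a \<Rightarrow> 'a \<Rightarrow> bool" and Ifr J Out :: "'a \<Rightarrow> bool"
  assumes fin: "finite N"
    and irr: "\<And>v. \<not> F v v"
    and FN: "\<And>v w. F v w \<Longrightarrow> v \<in> N \<and> w \<in> N"
    and J: "\<And>v. J v \<Longrightarrow> Ifr v"
    and iso: "\<And>v. v \<in> N \<Longrightarrow> Ifr v \<or> Out v \<or> (\<exists>w. F v w) \<or> (\<exists>w. F w v)"
  shows "\<exists>M\<subseteq>N. (\<forall>m\<in>M. \<not> Out m \<and> (Ifr m \<or> (\<exists>q\<in>N. F q m \<and> (q \<notin> M \<or> J q)))) \<and>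
    (\<forall>p\<in>N - M. Out p \<or> (\<exists>q. F p q \<and> (q \<in> M \<or> Out q)) \<or>
       \<not> J p \<and> (\<exists>q m. F p q \<and> F q m \<and> m \<in> M \<and> \<not> Ifr m \<and> \<not> J q))"
proof -
  define good where "good M \<longleftrightarrow> M \<subseteq> N \<and>
    (\<forall>m\<in>M. \<not> Out m \<and> (Ifr m \<or> (\<exists>q\<in>N. F q m \<and> (q \<notin> M \<or> J q))))" for M
  define M0 where "M0 = {v \<in> N. \<not> Out v \<and> (\<forall>w. \<not> F v w)}"
  have "good M0"
    unfolding good_def
  proof (intro conjI ballI)
    fix m assume m: "m \<in> M0"
    then show "\<not> Out m" by (simp add: M0_def)
    from m have "Ifr m \<or> (\<exists>q. F q m)" using iso[of m] by (auto simp: M0_def)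
    then show "Ifr m \<or> (\<exists>q\<in>N. F q m \<and> (q \<notin> M0 \<or> J q))"
      using FN by (auto simp: M0_def)
  qed (auto simp: M0_def)
  moreover have "finite {M. good M}"
    using fin by (rule_tac finite_subset[of _ "Pow N"]) (auto simp: good_def)
  ultimately obtain M where M: "good M" "M0 \<subseteq> M" and max: "\<And>M'. good M' \<Longrightarrow> M \<subseteq> M' \<Longrightarrow> M' = M"
    using finite_has_maximal2[of "{M. good M}" M0] by auto
  \<comment> \<open>By maximality an admissible \<open>p\<close> cannot be added, so some
    \<open>m \<in> M\<close> relied on \<open>p\<close> as a predecessor outside
    \<open>M\<close>.\<close>
  have ins: "\<exists>m\<in>M. \<not> Ifr m \<and> F p m \<and> \<not> J p"
    if p: "p \<in> N - M" "\<not> Out p" and ok: "Ifr p \<or> (\<exists>q\<in>N. F q p \<and> (q \<notin> M \<or> J q))" for p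
  proof (rule ccontr)
    assume neg: "\<not> ?thesis"
    have "good (insert p M)"
      unfolding good_def
    proof (intro conjI ballI)
      fix m assume m: "m \<in> insert p M"
      then show "\<not> Out m" using M(1) p(2) by (auto simp: good_def)
      show "Ifr m \<or> (\<exists>q\<in>N. F q m \<and> (q \<notin> insert p M \<or> J q))"
      proof (cases "m = p")
        case True
        then show ?thesis using ok irr by blast
      next
        case False
        then have "m \<in> M" using m by simp
        then have "Ifr m \<or> (\<exists>q\<in>N. F q m \<and> (q \<notin> M \<or> J q))" using M(1) by (simp add: good_def)
        then show ?thesis using neg \<open>m \<in> M\<close> by blast
      qed
    qed (use M(1) p in \<open>auto simp: good_def\<close>)
    then show False using max[of "insert p M"] p by auto
  qed
  show ?thesis
  proof (intro exI[of _ M] conjI ballI)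
    show "M \<subseteq> N" using M(1) by (simp add: good_def)
  next
    fix p assume p: "p \<in> N - M"
    show "Out p \<or> (\<exists>q. F p q \<and> (q \<in> M \<or> Out q)) \<or>
       \<not> J p \<and> (\<exists>q m. F p q \<and> F q m \<and> m \<in> M \<and> \<not> Ifr m \<and> \<not> J q)"
    proof (rule ccontr)
      assume neg: "\<not> ?thesis"
      \<comment> \<open>As \<open>p\<close> lies outside \<open>M0\<close>, it is not a sink. Its
        successor \<open>q\<close> has the predecessor \<open>p\<close> outside \<open>M\<close> and
        so is admissible; \<open>ins\<close> then gives the two-step route.\<close>
      then obtain q where q: "F p q" "q \<notin> M" "\<not> Out q"
        using M(2) p unfolding M0_def by blast
      then have "\<exists>m\<in>M. \<not> Ifr m \<and> F q m \<and> \<not> J q"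
        using ins[of q] FN p by blast
      moreover have "\<not> J p" using ins[of p] p neg J by blast
      ultimately show False using neg q by blast
    qed
  qed (use M(1) in \<open>auto simp: good_def\<close>)
qed

definition spokeless :: "'a \<Rightarrow> 'a set \<Rightarrow> 'a rel \<Rightarrow> 'a rel" where
  "spokeless s N D = D - ({s} \<times> N \<union> N \<times> {s})"

text \<open>Two set arguments make the definition self-dual: reversing all arcs swaps
  \<open>P\<close> and \<open>M\<close>. The main use has \<open>P = N - M\<close>.\<close>

definition respoke :: "'a \<Rightarrow> 'a set \<Rightarrow> 'a set \<Rightarrow> 'a rel \<Rightarrow> 'a rel" where
  "respoke s P M D = spokeless s (P \<union> M) D \<union> {s} \<times> P \<union> M \<times> {s}"

lemma spokeless_converse: "spokeless s N (D\<inverse>) = (spokeless s N D)\<inverse>"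
  by (auto simp: spokeless_def)

lemma respoke_converse: "respoke s P M (D\<inverse>) = (respoke s M P D)\<inverse>"
  by (auto simp: respoke_def spokeless_def)

locale strong_star =
  fixes V N :: "'a set" and s :: 'a and D :: "'a rel"
  assumes finite_V: "finite V"
    and D_V: "D \<subseteq> V \<times> V"
    and s_V: "s \<in> V"
    and N_V: "N \<subseteq> V - {s}"
    and antisym: "D \<inter> D\<inverse> = {}"
    and strong: "\<And>x y. x \<in> V \<Longrightarrow> y \<in> V \<Longrightarrow> (x, y) \<in> D\<^sup>*"
begin

lemma strong_star_converse: "strong_star V N s (D\<inverse>)"
  using finite_V D_V s_V N_V antisym strong
  by unfold_locales (auto simp: rtrancl_converse)

text \<open>Follow a walk to \<open>s\<close> up to its first vertex that is \<open>s\<close> or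
  another vertex of \<open>N\<close>. Before that only \<open>x\<close> can lie in \<open>N\<close>,
  and the hypothesis on \<open>x\<close> excludes its spoke, so no arc between \<open>s\<close> and
  \<open>N\<close> is used.\<close>

lemma exit_via_N:
  assumes x: "x \<in> V - {s}" and xs: "x \<in> N \<Longrightarrow> (x, s) \<notin> D"
  shows "(x, s) \<in> rtrancl_on (V - N \<union> {x}) (spokeless s N D) \<or>
    (\<exists>w\<in>N. w \<noteq> x \<and> (x, w) \<in> rtrancl_on (V - N \<union> {x, w}) (spokeless s N D))"
proof -
  define X where "X = V - N - {s} \<union> {x}"
  have "(x, s) \<in> rtrancl_on V D"
    using x s_V D_V strong by (intro rtrancl_imp_rtrancl_on) auto
  then obtain a b where
    xa: "(x, a) \<in> rtrancl_on (V \<inter> X) D" and ab: "(a, b) \<in> D" "b \<in> V - X"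
    by (rule rtrancl_on_exitE[of x s V D X]) (use x in \<open>auto simp: X_def\<close>)
  have aX: "a \<in> X" using in_rtrancl_on_in_F(2)[OF xa] by simp
  have xa': "(x, a) \<in> rtrancl_on X (spokeless s N D)"
    using x by (rule_tac rtrancl_on_subset[OF xa]) (auto simp: X_def spokeless_def)
  show ?thesis
  proof (cases "b = s")
    case True
    then have "(a, s) \<in> spokeless s N D"
      using ab(1) aX xs x by (auto simp: spokeless_def X_def)
    then show ?thesis
      using rtrancl_on_snoc[OF xa', of s "V - N \<union> {x}"] s_V N_V by (auto simp: X_def)
  next
    case False
    then have b: "b \<in> N" "b \<noteq> x" using ab(2) x by (auto simp: X_def)
    have "(a, b) \<in> spokeless s N D"
      using ab(1) aX False x by (auto simp: spokeless_def X_def)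
    then have "(x, b) \<in> rtrancl_on (V - N \<union> {x, b}) (spokeless s N D)"
      using rtrancl_on_snoc[OF xa', of b "V - N \<union> {x, b}"] by (auto simp: X_def)
    then show ?thesis using b by blast
  qed
qed

lemma entry_via_N:
  assumes x: "x \<in> V - {s}" and xs: "x \<in> N \<Longrightarrow> (s, x) \<notin> D"
  shows "(s, x) \<in> rtrancl_on (V - N \<union> {x}) (spokeless s N D) \<or>
    (\<exists>w\<in>N. w \<noteq> x \<and> (w, x) \<in> rtrancl_on (V - N \<union> {x, w}) (spokeless s N D))"
  using strong_star.exit_via_N[OF strong_star_converse x] xs
  by (auto simp: spokeless_converse rtrancl_on_converse)

end

context strong_star
begin

abbreviation (input) "Y \<equiv> V - N"
abbreviation (input) "K \<equiv> spokeless s N D"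
abbreviation (input) "reach S x y \<equiv> (x, y) \<in> rtrancl_on (V - N \<union> S) (spokeless s N D)"

text \<open>
  The vertices \<open>t\<close> and \<open>t'\<close> are two neighbours of \<open>s\<close> along arcs; \<open>T\<close> says that they are available.
  In the proof, \<open>J v\<close> says that \<open>v\<close> has an \<open>N\<close>-free connection from \<open>s\<close> that misses one of them.
\<close>

lemma respoke_few_N:
  fixes t t' :: 'a
  assumes T: "T \<longrightarrow> {t, t'} \<subseteq> V - N \<and> t \<noteq> t' \<and> (s, t) \<in> D \<and> ((s, t') \<in> D \<or> (t', s) \<in> D)"
  shows "\<exists>M\<subseteq>N. \<forall>x\<in>V. \<forall>y\<in>V. \<exists>W\<subseteq>V. (x, y) \<in> rtrancl_on W (respoke s (N - M) M D) \<and>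
    (card (W \<inter> N) \<le> 4 \<or> card (W \<inter> N) \<le> 5 \<and> (T \<longrightarrow> \<not> {t, t'} \<subseteq> W))"
proof -
  \<comment> \<open>\<open>V - N\<close> contains \<open>s\<close>, so these connections may pass
    through \<open>s\<close>, but only along arcs that are never redirected.\<close>
  define F where "F v w \<longleftrightarrow> v \<in> N \<and> w \<in> N \<and> v \<noteq> w \<and> reach {v, w} v w" for v w
  define Ifr where "Ifr v \<longleftrightarrow> reach {v} s v" for v
  define Out where "Out v \<longleftrightarrow> reach {v} v s" for v
  define J where "J v \<longleftrightarrow> (\<exists>z\<in>{t, t'}. (s, v) \<in> rtrancl_on (Y - {z} \<union> {v}) K)" for v
  have sY: "s \<in> Y" using s_V N_V by auto
  have finN: "finite N" using finite_V N_V finite_subset by blast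
  have J_Ifr: "Ifr v" if "J v" for v
    using that unfolding J_def Ifr_def by (auto elim!: rtrancl_on_mono[rotated 2])
  have "\<exists>M\<subseteq>N. (\<forall>m\<in>M. \<not> Out m \<and> (Ifr m \<or> (\<exists>q\<in>N. F q m \<and> (q \<notin> M \<or> J q)))) \<and>
    (\<forall>p\<in>N - M. Out p \<or> (\<exists>q. F p q \<and> (q \<in> M \<or> Out q)) \<or>
       \<not> J p \<and> (\<exists>q m. F p q \<and> F q m \<and> m \<in> M \<and> \<not> Ifr m \<and> \<not> J q))"
  proof (rule colouring_exists[OF finN _ _ J_Ifr])
    fix v assume v: "v \<in> N"
    then have "v \<in> V - {s}" using N_V by auto
    moreover have "(s, v) \<notin> D \<or> (v, s) \<notin> D" using antisym by auto
    ultimately have "(reach {v} v s \<or> (\<exists>w\<in>N. w \<noteq> v \<and> reach {v, w} v w)) \<or>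
        (reach {v} s v \<or> (\<exists>w\<in>N. w \<noteq> v \<and> reach {v, w} w v))"
      using exit_via_N[of v] entry_via_N[of v] by blast
    then show "Ifr v \<or> Out v \<or> (\<exists>w. F v w) \<or> (\<exists>w. F w v)"
      using v by (auto simp: F_def Ifr_def Out_def insert_commute)
  qed (auto simp: F_def)
  then obtain M where M: "M \<subseteq> N"
    and M_in: "\<forall>m\<in>M. \<not> Out m \<and> (Ifr m \<or> (\<exists>q\<in>N. F q m \<and> (q \<notin> M \<or> J q)))"
    and P_out: "\<forall>p\<in>N - M. Out p \<or> (\<exists>q. F p q \<and> (q \<in> M \<or> Out q)) \<or>
       \<not> J p \<and> (\<exists>q m. F p q \<and> F q m \<and> m \<in> M \<and> \<not> Ifr m \<and> \<not> J q)"
    by (elim exE conjE) (rule that)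
  define D' where "D' = respoke s (N - M) M D"
  have "N - M \<union> M = N" using M by auto
  then have D': "D' = K \<union> {s} \<times> (N - M) \<union> M \<times> {s}"
    by (simp add: D'_def respoke_def)
  have up: "(a, b) \<in> rtrancl_on W' D'" if "(a, b) \<in> rtrancl_on W K" "W \<subseteq> W'" for a b W W'
    using that D' by (auto intro: rtrancl_on_subset)
  have M_s: "(m, s) \<in> rtrancl_on W D'" if "m \<in> M" "m \<in> W" "s \<in> W" for m W
    using that D' by (auto intro!: rtrancl_on_snoc[OF rtrancl_on_refl, where W = W])
  have s_P: "(s, p) \<in> rtrancl_on W D'" if "p \<in> N - M" "p \<in> W" "s \<in> W" for p W
    using that D' by (auto intro!: rtrancl_on_snoc[OF rtrancl_on_refl, where W = W])
  have TK: "{t, t'} \<subseteq> Y" "t \<noteq> t'" "t \<noteq> s" "t' \<noteq> s" "(s, t) \<in> K" "(s, t') \<in> K \<or> (t', s) \<in> K" if T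
    using T that antisym N_V by (auto simp: spokeless_def)
  have to_s: "reach {v} v s" if "reach {v} v z" "(z, s) \<in> K" for v z
    using that sY by (intro rtrancl_on_snoc[OF that]) auto
  have from_s: "reach {v} s v" if "reach {v} z v" "(s, z) \<in> K" for v z
    using that sY by (intro rtrancl_on_Cons[OF that(2,1)]) auto
  \<comment> \<open>Without \<open>J v\<close>, the route from \<open>z\<close> to \<open>v\<close>
    must pass the other vertex \<open>z'\<close>, since otherwise \<open>s\<close>,
    \<open>z\<close>, \<open>v\<close> would miss it; and \<open>s\<close> cannot point to
    \<open>z'\<close>, since otherwise \<open>z\<close> could be skipped. So \<open>z'\<close>
    points to \<open>s\<close>, which forces \<open>z = t\<close> and
    \<open>z' = t'\<close>.\<close>
  have bad_entry: "(t', s) \<in> K \<and> reach {} t t'"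
    if "T" and z: "z \<in> {t, t'}" "(s, z) \<in> K" "reach {v} z v" and v: "v \<in> N" and "\<not> J v" for z v
  proof -
    define z' where "z' = (if z = t then t' else t)"
    have z': "z' \<in> {t, t'}" "z \<noteq> z'" "{z, z'} = {t, t'}"
      using z(1) TK(2)[OF \<open>T\<close>] by (auto simp: z'_def)
    then have Y': "z \<in> Y" "z' \<in> Y" "z \<noteq> s" "z' \<noteq> s" using TK[OF \<open>T\<close>] by auto
    have "v \<noteq> z" "v \<noteq> z'" "v \<notin> Y" using v Y' by auto
    have noJ: "(s, v) \<notin> rtrancl_on (Y - {w} \<union> {v}) K" if "w \<in> {t, t'}" for w
      using \<open>\<not> J v\<close> that by (auto simp: J_def)
    have "(z, v) \<notin> rtrancl_on (Y \<union> {v} - {z'}) K"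
    proof
      assume "(z, v) \<in> rtrancl_on (Y \<union> {v} - {z'}) K"
      then have "(s, v) \<in> rtrancl_on (Y - {z'} \<union> {v}) K"
        by (rule rtrancl_on_Cons[OF z(2)]) (use sY Y' in auto)
      then show False using noJ z'(1) by blast
    qed
    then have path: "(z, z') \<in> rtrancl_on (Y \<union> {v} - {v}) K" "(z', v) \<in> rtrancl_on (Y \<union> {v} - {z}) K"
      using rtrancl_on_detour[OF z(3), of z'] \<open>v \<noteq> z\<close> \<open>v \<noteq> z'\<close> z'(2) by auto
    have "(s, z') \<notin> K"
    proof
      assume "(s, z') \<in> K"
      then have "(s, v) \<in> rtrancl_on (Y - {z} \<union> {v}) K"
        by (rule rtrancl_on_Cons[OF _ path(2)]) (use sY Y' in auto)
      then show False using noJ z(1) by blast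
    qed
    then have "z' = t'" "z = t" "(t', s) \<in> K" using z' z TK(5,6)[OF \<open>T\<close>] by auto
    moreover have "Y \<union> {v} - {v} = Y \<union> {}" using \<open>v \<notin> Y\<close> by auto
    ultimately show ?thesis using path(1) by simp
  qed
  \<comment> \<open>The bonus in the three-vertex alternative, like the weaker one in
    \<open>arrive\<close>, lets a combination of five vertices miss one of \<open>t\<close>,
    \<open>t'\<close>.\<close>
  have leave: "\<exists>S\<subseteq>N. (x, s) \<in> rtrancl_on (Y \<union> S) D' \<and>
      (card S \<le> 2 \<or> card S \<le> 3 \<and> (T \<longrightarrow> (x, s) \<in> rtrancl_on (Y - {t, t'} \<union> S) D'))"
    if x: "x \<in> V" for x
  proof -
    have two: ?thesis if "S \<subseteq> N" "card S \<le> 2" "(x, s) \<in> rtrancl_on (Y \<union> S) D'" for S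
      using that by blast
    consider "x = s" | "x \<in> N" | "x \<in> Y - {s}" using x by auto
    then have "reach {} x s \<or> (\<exists>p\<in>N. reach {p} x p)"
    proof cases
      case 3
      then have "Y \<union> {x} = Y" "Y \<union> {x, w} = Y \<union> {w}" for w by auto
      then show ?thesis using exit_via_N[of x] 3 by auto
    qed (use sY in auto)
    then show ?thesis
    proof (elim disjE bexE)
      assume "reach {} x s"
      then show ?thesis by (intro two[of "{}"] up) auto
    next
      fix p assume p: "p \<in> N" "reach {p} x p"
      have via_p: ?thesis if "reach {p} p s"
        by (rule two[of "{p}"], use p in simp, simp,
            rule up[OF rtrancl_on_trans[OF p(2) that]]) simp
      have via_pq: ?thesis if "F p q" "(q, s) \<in> rtrancl_on (Y \<union> {p, q}) D'" for q
      proof (rule two[of "{p, q}"])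
        show "card {p, q} \<le> 2" by (simp add: card_insert_if)
        have "reach {p, q} p q" using that(1) by (simp add: F_def)
        then have "(x, q) \<in> rtrancl_on (Y \<union> {p, q}) K"
          by (rule rtrancl_on_join[OF p(2)]) auto
        then have "(x, q) \<in> rtrancl_on (Y \<union> {p, q}) D'" by (rule up) simp
        then show "(x, s) \<in> rtrancl_on (Y \<union> {p, q}) D'" by (rule rtrancl_on_trans) (rule that(2))
      qed (use that in \<open>auto simp: F_def\<close>)
      show ?thesis
      proof (cases "p \<in> M \<or> Out p \<or> (\<exists>q. F p q \<and> (q \<in> M \<or> Out q))")
        case True
        then show ?thesis
        proof (elim disjE exE conjE)
          assume "p \<in> M"
          have "(x, s) \<in> rtrancl_on (Y \<union> {p}) D'"
            by (rule rtrancl_on_trans[OF up[OF p(2)] M_s[OF \<open>p \<in> M\<close>]]) (use sY in auto)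
          then show ?thesis using p by (intro two[of "{p}"]) auto
        next
          assume "Out p"
          then show ?thesis by (intro via_p) (simp add: Out_def)
        next
          fix q assume "F p q" "q \<in> M"
          then show ?thesis by (intro via_pq[of q] M_s) (use sY in auto)
        next
          fix q assume "F p q" "Out q"
          then show ?thesis by (intro via_pq[of q] up[of q s "Y \<union> {q}"]) (auto simp: Out_def)
        qed
      next
        case False
        \<comment> \<open>What remains is the route \<open>p\<close>, \<open>q\<close>,
          \<open>m\<close>, \<open>s\<close> with three vertices of \<open>N\<close>. Visits to
          \<open>t\<close> or \<open>t'\<close> on it either shorten it or contradict one of the
          negative facts.\<close>
        then obtain q m where qm: "F p q" "F q m" "m \<in> M" "\<not> Ifr m" "\<not> J q"
          and no: "\<not> Out p" "\<not> Out q" "\<not> J p"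
          using P_out p by blast
        have N: "p \<in> N" "q \<in> N" "m \<in> N" "p \<noteq> q" "q \<noteq> m" using qm by (auto simp: F_def)
        have pq: "reach {p, q} p q" and qm': "reach {q, m} q m" using qm by (auto simp: F_def)
        have "(x, m) \<in> rtrancl_on (Y \<union> {p, q, m}) K"
          by (rule rtrancl_on_join[OF rtrancl_on_join[OF p(2) pq subset_refl] qm']) auto
        then have xs: "(x, s) \<in> rtrancl_on (Y \<union> {p, q, m}) D'"
          by (rule rtrancl_on_trans[OF up M_s[OF qm(3)]]) (use sY in auto)
        have c3: "card {p, q, m} \<le> 3" by (simp add: card_insert_if)
        show ?thesis
        proof (cases "T \<longrightarrow> (x, s) \<in> rtrancl_on (Y - {t, t'} \<union> {p, q, m}) D'")
          case True
          then show ?thesis using xs c3 N by (intro exI[of _ "{p, q, m}"]) auto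
        next
          case False
          then have T by simp
          note TK = TK[OF \<open>T\<close>]
          have dir: "(z, s) \<in> K \<or> (s, z) \<in> K" if "z \<in> {t, t'}" for z using that TK by auto
          have nN: "v \<noteq> t" "v \<noteq> t'" if "v \<in> N" for v using that TK(1) by auto
          show ?thesis
          proof (cases "\<exists>z\<in>{t, t'}. reach {p} x z \<and> reach {p} z p")
            case True
            then obtain z where z: "z \<in> {t, t'}" "reach {p} x z" "reach {p} z p" by blast
            \<comment> \<open>A visit to \<open>z\<close> on the way to \<open>p\<close> gives
              access to \<open>s\<close>: directly, or, if \<open>s\<close> points to
              \<open>z\<close>, from \<open>t\<close> to \<open>t'\<close> by
              \<open>bad_entry\<close>.\<close>
            obtain w where w: "reach {p} x w" "(w, s) \<in> K"
            proof (cases "(z, s) \<in> K")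
              case True
              then show ?thesis using that z by blast
            next
              case False
              then have "(s, z) \<in> K" using dir z by blast
              then have b: "(t', s) \<in> K" "reach {} t t'"
                using bad_entry[OF \<open>T\<close> z(1) _ z(3) p(1) no(3)] by auto
              then have "z = t" using z(1) False by auto
              then have "reach {p} x t'" using rtrancl_on_join[OF z(2) _ subset_refl] b(2)
                by (auto intro: rtrancl_on_join[OF z(2)])
              then show ?thesis using that b by blast
            qed
            have "(x, s) \<in> rtrancl_on (Y \<union> {p}) K"
              by (rule rtrancl_on_snoc[OF w]) (use sY in auto)
            then show ?thesis using p by (intro two[of "{p}"] up) auto
          next
            case no_z: False
            have s1: "(x, p) \<in> rtrancl_on (Y \<union> {p} - {t, t'}) K"
              using rtrancl_on_avoid_two[OF p(2), of t t'] no_z by blast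
            \<comment> \<open>A visited \<open>z\<close> cannot point to \<open>s\<close>, as
              \<open>Out p\<close> fails. If \<open>s\<close> points to \<open>z\<close>, then
              \<open>bad_entry\<close> leads from \<open>t\<close> to \<open>t'\<close> and on to
              \<open>s\<close>, with the same contradiction.\<close>
            have s2: "(p, q) \<in> rtrancl_on (Y \<union> {p, q} - {t, t'}) K"
            proof (rule ccontr)
              assume "\<not> ?thesis"
              then obtain z where z: "z \<in> {t, t'}"
                "(p, z) \<in> rtrancl_on (Y \<union> {p, q} - {q}) K" "(z, q) \<in> rtrancl_on (Y \<union> {p, q} - {p}) K"
                using rtrancl_on_detour_two[OF pq N(4), of t t'] N nN by auto
              have z': "reach {p} p z" "reach {q} z q"
                by (rule rtrancl_on_mono[OF subset_refl _ z(2)], auto)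
                   (rule rtrancl_on_mono[OF subset_refl _ z(3)], auto)
              have "(z, s) \<notin> K" using to_s[OF z'(1)] no(1) by (auto simp: Out_def)
              then have "(t', s) \<in> K" "reach {} t t'" "z = t"
                using bad_entry[OF \<open>T\<close> z(1) _ z'(2) N(2) qm(5)] dir[OF z(1)] z(1) by auto
              moreover have "reach {p} p t'"
                using calculation(2) z'(1) unfolding \<open>z = t\<close> by (auto intro: rtrancl_on_join)
              ultimately show False using to_s[of p t'] no(1) by (auto simp: Out_def)
            qed
            \<comment> \<open>One direction of the arc at \<open>z\<close> would yield
              \<open>Out q\<close>, the other \<open>Ifr m\<close>.\<close>
            have s3: "(q, m) \<in> rtrancl_on (Y \<union> {q, m} - {t, t'}) K"
            proof (rule ccontr)
              assume "\<not> ?thesis"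
              then obtain z where z: "z \<in> {t, t'}"
                "(q, z) \<in> rtrancl_on (Y \<union> {q, m} - {m}) K" "(z, m) \<in> rtrancl_on (Y \<union> {q, m} - {q}) K"
                using rtrancl_on_detour_two[OF qm' N(5), of t t'] N nN by auto
              have z': "reach {q} q z" "reach {m} z m"
                by (rule rtrancl_on_mono[OF subset_refl _ z(2)], auto)
                   (rule rtrancl_on_mono[OF subset_refl _ z(3)], auto)
              show False
                using dir[OF z(1)] to_s[OF z'(1)] from_s[OF z'(2)] no(2) qm(4)
                by (auto simp: Out_def Ifr_def)
            qed
            have "(x, m) \<in> rtrancl_on (Y - {t, t'} \<union> {p, q, m}) K"
              by (rule rtrancl_on_join[OF rtrancl_on_join[OF s1 s2 subset_refl] s3]) auto
            then have "(x, s) \<in> rtrancl_on (Y - {t, t'} \<union> {p, q, m}) D'"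
              by (rule rtrancl_on_trans[OF up M_s[OF qm(3)]]) (use sY TK in auto)
            then show ?thesis using False by blast
          qed
        qed
      qed
    qed
  qed
  have arrive: "\<exists>S\<subseteq>N. (s, y) \<in> rtrancl_on (Y \<union> S) D' \<and>
      (card S \<le> 1 \<or> card S \<le> 2 \<and> (T \<longrightarrow> (\<exists>z\<in>{t, t'}. (s, y) \<in> rtrancl_on (Y - {z} \<union> S) D')))"
    if y: "y \<in> V" for y
  proof -
    have one: ?thesis if "S \<subseteq> N" "card S \<le> 1" "(s, y) \<in> rtrancl_on (Y \<union> S) D'" for S
      using that by blast
    consider "y = s" | "y \<in> N" | "y \<in> Y - {s}" using y by auto
    then have "reach {} s y \<or> (\<exists>v\<in>N. reach {v} v y)"
    proof cases
      case 3
      then have "Y \<union> {y} = Y" "Y \<union> {y, w} = Y \<union> {w}" for w by auto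
      then show ?thesis using entry_via_N[of y] 3 by auto
    qed (use sY in auto)
    then show ?thesis
    proof (elim disjE bexE)
      assume "reach {} s y"
      then show ?thesis by (intro one[of "{}"] up) auto
    next
      fix v assume v: "v \<in> N" "reach {v} v y"
      have via_v: ?thesis if "(s, v) \<in> rtrancl_on (Y \<union> {v}) D'"
        by (rule one[of "{v}"], use v in simp, simp,
            rule rtrancl_on_trans[OF that up[OF v(2) subset_refl]])
      show ?thesis
      proof (cases "v \<notin> M \<or> Ifr v")
        case True
        then show ?thesis
        proof
          assume "v \<notin> M"
          then show ?thesis using v sY by (intro via_v s_P) auto
        next
          assume "Ifr v"
          then show ?thesis by (intro via_v up[of s v "Y \<union> {v}"]) (auto simp: Ifr_def)
        qed
      next
        case False
        \<comment> \<open>Now \<open>v\<close> is reached through a predecessor \<open>q\<close>: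
          along the spoke from \<open>s\<close> if \<open>q \<notin> M\<close>, and by the
          connection behind \<open>J q\<close> otherwise.\<close>
        then obtain q where q: "F q v" "q \<notin> M \<or> J q" and no: "v \<in> M" "\<not> Out v" "\<not> Ifr v"
          using M_in by blast
        have N: "q \<in> N" "q \<noteq> v" and qv: "reach {q, v} q v" using q by (auto simp: F_def)
        have c2: "card {q, v} \<le> 2" by (simp add: card_insert_if)
        have sq: "(s, q) \<in> rtrancl_on (Y \<union> {q}) D'"
        proof (cases "q \<in> M")
          case True
          then have "Ifr q" using q J_Ifr by blast
          then show ?thesis by (intro up[of s q "Y \<union> {q}"]) (auto simp: Ifr_def)
        qed (use N sY in \<open>auto intro!: s_P\<close>)
        have "(q, y) \<in> rtrancl_on (Y \<union> {q, v}) K"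
          by (rule rtrancl_on_join[OF qv v(2)]) auto
        then have "(q, y) \<in> rtrancl_on (Y \<union> {q, v}) D'" by (rule up) simp
        then have sy: "(s, y) \<in> rtrancl_on (Y \<union> {q, v}) D'"
          by (rule rtrancl_on_join[OF sq]) auto
        show ?thesis
        proof (cases "T \<longrightarrow> (\<exists>z\<in>{t, t'}. (s, y) \<in> rtrancl_on (Y - {z} \<union> {q, v}) D')")
          case True
          then show ?thesis using sy c2 N v by (intro exI[of _ "{q, v}"]) auto
        next
          case False
          then have T by simp
          note TK = TK[OF \<open>T\<close>]
          have dir: "(z, s) \<in> K \<or> (s, z) \<in> K" if "z \<in> {t, t'}" for z using that TK by auto
          have nN: "u \<noteq> t" "u \<noteq> t'" if "u \<in> N" for u using that TK(1) by auto
          show ?thesis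
          proof (cases "\<exists>z\<in>{t, t'}. reach {v} v z \<and> reach {v} z y")
            case True
            then obtain z where z: "z \<in> {t, t'}" "reach {v} v z" "reach {v} z y" by blast
            have "(s, z) \<in> K" using dir[OF z(1)] to_s[OF z(2)] no by (auto simp: Out_def)
            then have "reach {v} s y" by (rule rtrancl_on_Cons[OF _ z(3)]) (use sY in auto)
            then show ?thesis using v by (intro one[of "{v}"] up) auto
          next
            case no_z: False
            have s1: "(v, y) \<in> rtrancl_on (Y \<union> {v} - {t, t'}) K"
              using rtrancl_on_avoid_two[OF v(2), of t t'] no_z by blast
            show ?thesis
            proof (cases "q \<in> M")
              case False
              \<comment> \<open>Avoiding \<open>t\<close> alone suffices here: \<open>s\<close>
                points to \<open>t\<close>, so a visit to \<open>t\<close> would yield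
                \<open>Ifr v\<close>.\<close>
              have s2: "(q, v) \<in> rtrancl_on (Y \<union> {q, v} - {t}) K"
              proof (rule ccontr)
                assume "\<not> ?thesis"
                then have "(t, v) \<in> rtrancl_on (Y \<union> {q, v} - {q}) K"
                  using rtrancl_on_detour[OF qv N(2), of t] nN N v by auto
                then have "reach {v} t v" by (rule rtrancl_on_mono[OF subset_refl, rotated]) auto
                then show False using from_s TK(5) no(3) by (auto simp: Ifr_def)
              qed
              have "(q, y) \<in> rtrancl_on (Y - {t} \<union> {q, v}) K"
                by (rule rtrancl_on_join[OF s2 s1]) auto
              then have "(s, y) \<in> rtrancl_on (Y - {t} \<union> {q, v}) D'"
                by (intro rtrancl_on_trans[OF s_P[of q] up]) (use N False sY TK in auto)
              then show ?thesis using \<open>\<not> (T \<longrightarrow> _)\<close> by blast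
            next
              case True
              then have "J q" "\<not> Out q" using q M_in by auto
              then obtain z0 where z0: "z0 \<in> {t, t'}" "(s, q) \<in> rtrancl_on (Y - {z0} \<union> {q}) K"
                by (auto simp: J_def)
              have s2: "(q, v) \<in> rtrancl_on (Y \<union> {q, v} - {t, t'}) K"
              proof (rule ccontr)
                assume "\<not> ?thesis"
                then obtain z where z: "z \<in> {t, t'}"
                  "(q, z) \<in> rtrancl_on (Y \<union> {q, v} - {v}) K" "(z, v) \<in> rtrancl_on (Y \<union> {q, v} - {q}) K"
                  using rtrancl_on_detour_two[OF qv N(2), of t t'] N nN v by auto
                have z': "reach {q} q z" "reach {v} z v"
                  by (rule rtrancl_on_mono[OF subset_refl _ z(2)], auto)
                     (rule rtrancl_on_mono[OF subset_refl _ z(3)], auto)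
                show False
                  using dir[OF z(1)] to_s[OF z'(1)] from_s[OF z'(2)] no(3) \<open>\<not> Out q\<close>
                  by (auto simp: Out_def Ifr_def)
              qed
              have "(q, y) \<in> rtrancl_on (Y - {z0} \<union> {q, v}) K"
                by (rule rtrancl_on_join[OF s2 s1]) (use z0(1) in auto)
              moreover have "(s, q) \<in> rtrancl_on (Y - {z0} \<union> {q, v}) K"
                by (rule rtrancl_on_mono[OF subset_refl _ z0(2)]) auto
              ultimately have "(s, y) \<in> rtrancl_on (Y - {z0} \<union> {q, v}) D'"
                by (intro up[OF rtrancl_on_trans]) auto
              then show ?thesis using False z0(1) by blast
            qed
          qed
        qed
      qed
    qed
  qed
  show ?thesis
  proof (rule exI[of _ M], intro conjI ballI)
    show "M \<subseteq> N" by (rule M)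
  next
    fix x y assume xy: "x \<in> V" "y \<in> V"
    obtain S1 where S1: "S1 \<subseteq> N" "(x, s) \<in> rtrancl_on (Y \<union> S1) D'"
      "card S1 \<le> 2 \<or> card S1 \<le> 3 \<and> (T \<longrightarrow> (x, s) \<in> rtrancl_on (Y - {t, t'} \<union> S1) D')"
      using leave[OF xy(1)] by blast
    obtain S2 where S2: "S2 \<subseteq> N" "(s, y) \<in> rtrancl_on (Y \<union> S2) D'"
      "card S2 \<le> 1 \<or> card S2 \<le> 2 \<and> (T \<longrightarrow> (\<exists>z\<in>{t, t'}. (s, y) \<in> rtrancl_on (Y - {z} \<union> S2) D'))"
      using arrive[OF xy(2)] by blast
    have cardU: "card (S1 \<union> S2) \<le> card S1 + card S2" by (rule card_Un_le)
    have int: "(Y - Z \<union> (S1 \<union> S2)) \<inter> N = S1 \<union> S2" for Z using S1(1) S2(1) by auto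
    have sub: "Y - Z \<union> (S1 \<union> S2) \<subseteq> V" for Z using S1(1) S2(1) N_V by auto
    have all: "(x, y) \<in> rtrancl_on (Y - {} \<union> (S1 \<union> S2)) D'"
      using S1(2) S2(2) by (rule rtrancl_on_join) auto
    have "\<exists>W\<subseteq>V. (x, y) \<in> rtrancl_on W D' \<and>
      (card (W \<inter> N) \<le> 4 \<or> card (W \<inter> N) \<le> 5 \<and> (T \<longrightarrow> \<not> {t, t'} \<subseteq> W))"
    \<comment> \<open>A total of five arises only as 3 + 2. Both bonuses then apply, and the joined
      route misses one \<open>z\<close>.\<close>
    proof (cases "card S1 + card S2 \<le> 4 \<or> \<not> T")
      case True
      then have "card (S1 \<union> S2) \<le> 4 \<or> card (S1 \<union> S2) \<le> 5 \<and> \<not> T"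
        using cardU S1(3) S2(3) by linarith
      then show ?thesis
        using all sub[of "{}"] int[of "{}"]
        by (intro exI[of _ "Y - {} \<union> (S1 \<union> S2)"]) auto
    next
      case False
      then have "card S1 + card S2 \<le> 5" "\<not> card S1 \<le> 2" "\<not> card S2 \<le> 1"
        using S1(3) S2(3) by linarith+
      then obtain z where z: "z \<in> {t, t'}" "(s, y) \<in> rtrancl_on (Y - {z} \<union> S2) D'"
        and S1': "(x, s) \<in> rtrancl_on (Y - {t, t'} \<union> S1) D'"
        using S1(3) S2(3) False by blast
      have "(x, y) \<in> rtrancl_on (Y - {z} \<union> (S1 \<union> S2)) D'"
        by (rule rtrancl_on_join[OF S1' z(2)]) (use z(1) in auto)
      moreover have "z \<notin> Y - {z} \<union> (S1 \<union> S2)"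
        using TK(1) False z(1) S1(1) S2(1) by blast
      ultimately show ?thesis
        using sub[of "{z}"] int[of "{z}"] cardU \<open>card S1 + card S2 \<le> 5\<close> z(1)
        by (intro exI[of _ "Y - {z} \<union> (S1 \<union> S2)"]) auto
    qed
    then show "\<exists>W\<subseteq>V. (x, y) \<in> rtrancl_on W (respoke s (N - M) M D) \<and>
      (card (W \<inter> N) \<le> 4 \<or> card (W \<inter> N) \<le> 5 \<and> (T \<longrightarrow> \<not> {t, t'} \<subseteq> W))"
      by (simp only: D'_def)
  qed
qed

end

text \<open>If one of the two arcs leaves \<open>s\<close>, its end takes the role of
  \<open>t\<close>. If both enter \<open>s\<close>, reverse all arcs, which exchanges
  \<open>M\<close> and \<open>N - M\<close>.\<close>

lemma (in strong_star) respoke_few_N_sym: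
  fixes t t' :: 'a
  assumes T: "T \<longrightarrow> {t, t'} \<subseteq> V - N \<and> t \<noteq> t' \<and> (\<forall>z\<in>{t, t'}. (s, z) \<in> D \<or> (z, s) \<in> D)"
  shows "\<exists>M\<subseteq>N. \<forall>x\<in>V. \<forall>y\<in>V. \<exists>W\<subseteq>V. (x, y) \<in> rtrancl_on W (respoke s (N - M) M D) \<and>
    (card (W \<inter> N) \<le> 4 \<or> card (W \<inter> N) \<le> 5 \<and> (T \<longrightarrow> \<not> {t, t'} \<subseteq> W))"
proof -
  consider "T \<longrightarrow> (s, t) \<in> D" | "T \<longrightarrow> (s, t') \<in> D" | "T \<longrightarrow> (t, s) \<in> D \<and> (t', s) \<in> D"
    using T by blast
  then show ?thesis
  proof cases
    case 1
    then have "T \<longrightarrow> {t, t'} \<subseteq> V - N \<and> t \<noteq> t' \<and> (s, t) \<in> D \<and> ((s, t') \<in> D \<or> (t', s) \<in> D)"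
      using T by auto
    then show ?thesis by (rule respoke_few_N)
  next
    case 2
    then have T': "T \<longrightarrow> {t', t} \<subseteq> V - N \<and> t' \<noteq> t \<and> (s, t') \<in> D \<and> ((s, t) \<in> D \<or> (t, s) \<in> D)"
      using T by auto
    show ?thesis using respoke_few_N[OF T'] by (simp only: insert_commute)
  next
    case 3
    then have T': "T \<longrightarrow> {t, t'} \<subseteq> V - N \<and> t \<noteq> t' \<and>
        (s, t) \<in> D\<inverse> \<and> ((s, t') \<in> D\<inverse> \<or> (t', s) \<in> D\<inverse>)"
      using T by auto
    obtain M where M: "M \<subseteq> N" "\<forall>x\<in>V. \<forall>y\<in>V. \<exists>W\<subseteq>V. (x, y) \<in> rtrancl_on W (respoke s (N - M) M (D\<inverse>)) \<and>
      (card (W \<inter> N) \<le> 4 \<or> card (W \<inter> N) \<le> 5 \<and> (T \<longrightarrow> \<not> {t, t'} \<subseteq> W))"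
      using strong_star.respoke_few_N[OF strong_star_converse T'] by (elim exE conjE) (rule that)
    then have M': "\<exists>W\<subseteq>V. (x, y) \<in> rtrancl_on W (respoke s M (N - M) D) \<and>
      (card (W \<inter> N) \<le> 4 \<or> card (W \<inter> N) \<le> 5 \<and> (T \<longrightarrow> \<not> {t, t'} \<subseteq> W))" if "x \<in> V" "y \<in> V" for x y
      using that by (simp add: respoke_converse rtrancl_on_converse)
    have "N - (N - M) = M" using M(1) by auto
    then show ?thesis using M' by (intro exI[of _ "N - M"]) simp
  qed
qed

section \<open>Mixed graphs and their oriented diameter\<close>

text \<open>Undirected edges become pairs of opposite arcs, and simplicity makes these the only
  symmetric pairs (\<open>sym_traversal_iff\<close>). An orientation keeps one arc of each such
  pair.\<close>

definition traversal :: "'a mixed_graph \<Rightarrow> 'a rel" where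
  "traversal G = {(x, y). {x, y} \<in> medges G \<or> (x, y) \<in> marcs G}"

definition orients :: "'a rel \<Rightarrow> 'a rel \<Rightarrow> bool" where
  "orients D R \<longleftrightarrow> D \<subseteq> R \<and> R \<subseteq> D \<union> D\<inverse> \<and> D \<inter> D\<inverse> = {}"

lemma respoke_orients:
  assumes "orients D R" "irrefl R"
    and "N = {v. (s, v) \<in> R \<and> (v, s) \<in> R}" "M \<subseteq> N"
  shows "orients (respoke s (N - M) M D) R"
proof -
  have "N - M \<union> M = N" "s \<notin> N" using assms by (auto simp: irrefl_def)
  then show ?thesis
    using assms by (auto simp: orients_def respoke_def spokeless_def)
qed

context mixed_graph
begin

lemma medgeE:
  assumes "{x, y} \<in> medges G"
  shows "x \<in> mverts G" "y \<in> mverts G" "x \<noteq> y"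
proof -
  obtain a b where "a \<in> mverts G" "b \<in> mverts G" "a \<noteq> b" "{x, y} = {a, b}"
    using medges_wf[OF assms] by blast
  then show "x \<in> mverts G" "y \<in> mverts G" "x \<noteq> y" by (auto simp: doubleton_eq_iff)
qed

lemma traversal_V: "traversal G \<subseteq> mverts G \<times> mverts G"
  using medgeE marcs_wf by (auto simp: traversal_def)

lemma finite_traversal: "finite (traversal G)"
  using traversal_V finite_mverts finite_subset by blast

lemma irrefl_traversal: "irrefl (traversal G)"
  unfolding irrefl_def traversal_def using medgeE(3) marcs_wf by blast

lemma sym_traversal_iff: "(x, y) \<in> traversal G \<and> (y, x) \<in> traversal G \<longleftrightarrow> {x, y} \<in> medges G"
  unfolding traversal_def using marcs_simple by (auto simp: insert_commute)

lemma mixed_connected_traversal: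
  assumes "mixed_connected G" "x \<in> mverts G" "y \<in> mverts G"
  shows "(x, y) \<in> (traversal G)\<^sup>*"
proof -
  obtain p where p: "orientable_path G x p y" using assms unfolding mixed_connected_def by blast
  have "(hd p, last p) \<in> (traversal G)\<^sup>*"
    if "p \<noteq> []" "successively (\<lambda>u v. {u, v} \<in> medges G \<or> (u, v) \<in> marcs G) p" for p
    using that
  proof (induction p rule: induct_list012)
    case (3 a b zs)
    then have "(a, b) \<in> traversal G" "(b, last (b # zs)) \<in> (traversal G)\<^sup>*"
      by (auto simp: traversal_def)
    then show ?case by (auto intro: converse_rtrancl_into_rtrancl)
  qed auto
  then show ?thesis using p unfolding orientable_path_def by blast
qed

lemma connected_underlying:
  assumes "mixed_connected G"
  shows "connected (with_proj (underlying G))"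
proof -
  have "(x, y) \<in> rtrancl_on (mverts G) (parcs (mk_symmetric (with_proj (underlying G))))"
    if "x \<in> mverts G" "y \<in> mverts G" for x y
  proof (rule rtrancl_imp_rtrancl_on[OF _ that])
    have "traversal G \<subseteq> parcs (mk_symmetric (with_proj (underlying G)))"
      by (auto simp: parcs_mk_symmetric traversal_def underlying_def)
    then show "(x, y) \<in> (parcs (mk_symmetric (with_proj (underlying G))))\<^sup>*"
      using mixed_connected_traversal[OF assms that] rtrancl_mono by blast
    show "parcs (mk_symmetric (with_proj (underlying G))) \<subseteq> mverts G \<times> mverts G"
      using medgeE marcs_wf by (fastforce simp: parcs_mk_symmetric underlying_def)
  qed
  then show ?thesis
    unfolding connected_def strongly_connected_def reachable_def
    using mverts_nonempty by (auto simp: underlying_def)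
qed

text \<open>\<open>bridge\<close> presupposes a connected underlying graph, which
  \<open>connected_underlying\<close> supplies. By simplicity no arc joins \<open>x\<close> and
  \<open>y\<close>, so deleting the edge removes both pairs.\<close>

lemma bridgeless_traversal:
  assumes "bridgeless G" and xy: "{x, y} \<in> medges G"
  shows "(x, y) \<in> ((traversal G \<union> (traversal G)\<inverse>) - {(x, y), (y, x)})\<^sup>*"
proof -
  let ?H = "with_proj (underlying (G\<lparr>medges := medges G - {{x, y}}\<rparr>))"
  have "connected ?H"
    using assms connected_underlying unfolding bridgeless_def bridge_def by blast
  then have "(x, y) \<in> rtrancl_on (mverts G) (parcs (mk_symmetric ?H))"
    unfolding connected_def strongly_connected_def reachable_def
    using medgeE[OF xy] by (auto simp: underlying_def)
  then have "(x, y) \<in> (parcs (mk_symmetric ?H))\<^sup>*" by (rule rtrancl_on_rtranclI)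
  moreover have "parcs (mk_symmetric ?H) \<subseteq> (traversal G \<union> (traversal G)\<inverse>) - {(x, y), (y, x)}"
  proof -
    have "(a, b) \<noteq> (x, y) \<and> (a, b) \<noteq> (y, x)" if "(a, b) \<in> marcs G" for a b
      using marcs_simple[OF that] xy by (auto simp: insert_commute)
    then show ?thesis
      by (fastforce simp: parcs_mk_symmetric underlying_def traversal_def insert_commute)
  qed
  ultimately show ?thesis using rtrancl_mono by blast
qed

lemma bridgeless_strong_orientation:
  assumes "bridgeless G"
  obtains D where "orients D (traversal G)" "\<forall>x\<in>mverts G. \<forall>y\<in>mverts G. (x, y) \<in> D\<^sup>*"
proof -
  have "mixed_connected G" using assms by (simp add: bridgeless_def)
  then have "\<exists>D\<subseteq>traversal G. traversal G \<subseteq> D \<union> D\<inverse> \<and> D \<inter> D\<inverse> = {} \<and>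
      (\<forall>x\<in>mverts G. \<forall>y\<in>mverts G. (x, y) \<in> D\<^sup>*)"
    using mixed_connected_traversal bridgeless_traversal[OF assms] sym_traversal_iff
    by (intro strong_orientation_exists finite_traversal traversal_V irrefl_traversal) blast+
  then show ?thesis using that unfolding orients_def by blast
qed

lemma orients_orientation:
  assumes "orients D (traversal G)"
  shows "orientation G \<lparr>pverts = mverts G, parcs = D\<rparr>"
proof -
  have R: "D \<subseteq> traversal G" "traversal G \<subseteq> D \<union> D\<inverse>" and anti: "D \<inter> D\<inverse> = {}"
    using assms by (simp_all add: orients_def)
  have "marcs G \<subseteq> D"
  proof
    fix a assume a: "a \<in> marcs G"
    obtain x y where xy: "a = (x, y)" by (cases a)
    have "(y, x) \<notin> traversal G"
      using marcs_simple[of x y] a xy by (auto simp: traversal_def insert_commute)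
    moreover have "(x, y) \<in> traversal G" using a xy by (simp add: traversal_def)
    ultimately show "a \<in> D" using R xy by blast
  qed
  moreover have "(x, y) \<in> D \<longleftrightarrow> (y, x) \<notin> D" if "{x, y} \<in> medges G" for x y
    using that R anti unfolding sym_traversal_iff[symmetric] by blast
  ultimately show ?thesis
    using R(1) by (auto simp: orientation_def traversal_def)
qed

lemma card_neighbours: "undirected_degree G s = card {v. {s, v} \<in> medges G}"
proof -
  have "{e \<in> medges G. s \<in> e} = (\<lambda>v. {s, v}) ` {v. {s, v} \<in> medges G}"
  proof (intro equalityI subsetI)
    fix e assume e: "e \<in> {e \<in> medges G. s \<in> e}"
    then obtain x y where "e = {x, y}" using medges_wf by blast
    then have "e = {s, x} \<or> e = {s, y}" using e by auto
    then show "e \<in> (\<lambda>v. {s, v}) ` {v. {s, v} \<in> medges G}" using e by auto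
  qed auto
  moreover have "inj_on (\<lambda>v. {s, v}) {v. {s, v} \<in> medges G}"
    by (auto simp: inj_on_def doubleton_eq_iff)
  ultimately show ?thesis by (simp add: undirected_degree_def card_image)
qed

lemma two_arcs:
  assumes "arc_out_degree G s + arc_in_degree G s \<ge> 2"
  obtains t t' where "t \<noteq> t'" "(s, t) \<in> marcs G \<or> (t, s) \<in> marcs G" "(s, t') \<in> marcs G \<or> (t', s) \<in> marcs G"
proof -
  let ?S = "{t. (s, t) \<in> marcs G}" and ?T = "{t. (t, s) \<in> marcs G}"
  have "{a \<in> marcs G. fst a = s} = Pair s ` ?S" "{a \<in> marcs G. snd a = s} = (\<lambda>t. (t, s)) ` ?T"
    by auto
  then have "arc_out_degree G s = card ?S" "arc_in_degree G s = card ?T"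
    by (simp_all add: arc_out_degree_def arc_in_degree_def card_image inj_on_def)
  moreover have fin: "finite ?S" "finite ?T"
    by (rule finite_subset[OF _ finite_mverts], use marcs_wf in blast)+
  moreover have "?S \<inter> ?T = {}" using marcs_simple by auto
  ultimately have "card (?S \<union> ?T) \<ge> 2" using assms by (simp add: card_Un_disjoint)
  then obtain t t' where "t \<in> ?S \<union> ?T" "t' \<in> ?S \<union> ?T" "t \<noteq> t'"
    by (meson card_2_iff' obtain_subset_with_card_n subsetD)
  then show ?thesis using that by blast
qed

end

text \<open>Each arc has exactly one end in \<open>A\<close>, and each visit to \<open>A\<close> is
  an end of two arcs of the walk, except at the ends of the walk, which the \<open>of_bool\<close>
  terms correct.\<close>

lemma alternating_walk_length:
  assumes "D \<subseteq> A \<times> B \<union> B \<times> A" "A \<inter> B = {}"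
    and "pcas u p v" "set p \<subseteq> D"
  shows "length p + of_bool (u \<in> A) + of_bool (v \<in> A) = 2 * length (filter (\<lambda>z. z \<in> A) (pawalk_verts u p))"
  using assms(3,4)
proof (induction p arbitrary: u)
  case (Cons e p)
  obtain w where e: "e = (u, w)" using Cons.prems by (cases e) auto
  have "length p + of_bool (w \<in> A) + of_bool (v \<in> A) = 2 * length (filter (\<lambda>z. z \<in> A) (pawalk_verts w p))"
    using Cons e by auto
  moreover have "(u, w) \<in> A \<times> B \<union> B \<times> A" using Cons.prems e assms(1) by auto
  then have "u \<in> A \<longleftrightarrow> w \<notin> A" using assms(2) by auto
  ultimately show ?case using e by auto
qed auto

text \<open>A path with distinct vertices inside \<open>W\<close> visits at most
  \<open>card (W \<inter> A)\<close> vertices of \<open>A\<close>; alternation turns this into a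
  bound on its length.\<close>

lemma digraph_dist_le:
  fixes D :: "'a rel"
  assumes bip: "D \<subseteq> A \<times> B \<union> B \<times> A" "A \<inter> B = {}"
    and D: "D \<subseteq> V \<times> V" and W: "W \<subseteq> V" "finite V" and xy: "(x, y) \<in> rtrancl_on W D"
  shows "digraph_dist \<lparr>pverts = V, parcs = D\<rparr> x y + enat (of_bool (x \<in> A) + of_bool (y \<in> A))
    \<le> enat (2 * card (W \<inter> A))"
proof -
  define H where "H = \<lparr>pverts = W, parcs = D \<inter> W \<times> W\<rparr>"
  interpret H: pair_wf_digraph H by unfold_locales (auto simp: H_def)
  have "(x, y) \<in> rtrancl_on (pverts H) (parcs H)"
    using xy by (rule rtrancl_on_subset) (auto simp: H_def)
  then have "reachable (with_proj H) x y" by (simp add: reachable_def)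
  then obtain p where p: "H.apath x p y" using H.reachable_apath by blast
  then have p': "set p \<subseteq> D" "pcas x p y" "distinct (pawalk_verts x p)" "x \<in> V"
    "set (pawalk_verts x p) \<subseteq> W"
    using W H.awalk_verts_in_verts[of x p] unfolding H.apath_def H.awalk_def by (auto simp: H_def)
  have "pre_digraph.apath (with_proj \<lparr>pverts = V, parcs = D\<rparr>) x p y"
    using p' unfolding pre_digraph.apath_def pre_digraph.awalk_def
    by (simp add: cas_with_proj_eq awalk_verts_with_proj_eq)
  then have "digraph_dist \<lparr>pverts = V, parcs = D\<rparr> x y \<le> enat (length p)"
    unfolding digraph_dist_def by (intro INF_lower) simp
  moreover have "length (filter (\<lambda>z. z \<in> A) (pawalk_verts x p)) \<le> card (W \<inter> A)"
  proof -
    have "length (filter (\<lambda>z. z \<in> A) (pawalk_verts x p)) = card (set (filter (\<lambda>z. z \<in> A) (pawalk_verts x p)))"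
      using p'(3) by (intro distinct_card[symmetric] distinct_filter)
    also have "\<dots> \<le> card (W \<inter> A)"
      using p'(5) W by (intro card_mono) (auto intro: finite_subset)
    finally show ?thesis .
  qed
  then have "length p + (of_bool (x \<in> A) + of_bool (y \<in> A)) \<le> 2 * card (W \<inter> A)"
    using alternating_walk_length[OF bip p'(2,1)] by simp
  ultimately show ?thesis
    by (cases "digraph_dist \<lparr>pverts = V, parcs = D\<rparr> x y") auto
qed

text \<open>The term \<open>d\<close> is added on the left to avoid truncated subtraction. The sets
  \<open>W\<close> serve twice: they bound all distances and show that the orientation is
  strong.\<close>

lemma (in mixed_graph) oriented_diam_le:
  assumes bip: "mixed_bipartite G A B"
    and D: "orients D (traversal G)"
    and W: "\<And>x y. x \<in> mverts G \<Longrightarrow> y \<in> mverts G \<Longrightarrow> \<exists>W\<subseteq>mverts G. (x, y) \<in> rtrancl_on W D \<and>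
      2 * card (W \<inter> A) + d \<le> k + of_bool (x \<in> A) + of_bool (y \<in> A)"
  shows "oriented_diam G + enat d \<le> enat k"
proof -
  let ?H = "\<lparr>pverts = mverts G, parcs = D\<rparr>"
  have DV: "D \<subseteq> mverts G \<times> mverts G" using D traversal_V by (auto simp: orients_def)
  have AB: "traversal G \<subseteq> A \<times> B \<union> B \<times> A" "A \<inter> B = {}"
    using bip unfolding mixed_bipartite_def traversal_def by (fastforce simp: doubleton_eq_iff)+
  then have AB': "D \<subseteq> A \<times> B \<union> B \<times> A" using D by (auto simp: orients_def)
  have dist: "digraph_dist ?H x y + enat d \<le> enat k" if xy: "x \<in> mverts G" "y \<in> mverts G" for x y
  proof -
    obtain W where W: "W \<subseteq> mverts G" "(x, y) \<in> rtrancl_on W D"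
      "2 * card (W \<inter> A) + d \<le> k + of_bool (x \<in> A) + of_bool (y \<in> A)"
      using assms(3)[OF xy] by blast
    have "digraph_dist ?H x y + enat (of_bool (x \<in> A) + of_bool (y \<in> A)) \<le> enat (2 * card (W \<inter> A))"
      by (rule digraph_dist_le[OF AB' AB(2) DV W(1) finite_mverts W(2)])
    then show ?thesis using W(3) by (cases "digraph_dist ?H x y") auto
  qed
  \<comment> \<open>The pair \<open>(v, v)\<close> yields \<open>d \<le> k\<close>, so
    \<open>k - d\<close> below is a true difference.\<close>
  obtain v where v: "v \<in> mverts G" using mverts_nonempty by auto
  then have "d \<le> k" using dist[OF v v] by (cases "digraph_dist ?H v v") auto
  have "digraph_dist ?H x y \<le> enat (k - d)" if "x \<in> mverts G" "y \<in> mverts G" for x y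
    using dist[OF that] by (cases "digraph_dist ?H x y") auto
  then have "digraph_diam ?H \<le> enat (k - d)"
    unfolding digraph_diam_def by (intro SUP_least) auto
  moreover have "strong_orientation G ?H"
    unfolding strong_orientation_def strongly_connected_def reachable_def
  proof (intro conjI ballI)
    fix x y assume "x \<in> verts (with_proj ?H)" "y \<in> verts (with_proj ?H)"
    then obtain W where "W \<subseteq> mverts G" "(x, y) \<in> rtrancl_on W D" using W by force
    then show "(x, y) \<in> rtrancl_on (verts (with_proj ?H)) (arcs_ends (with_proj ?H))"
      using rtrancl_on_mono by fastforce
  qed (use mverts_nonempty orients_orientation[OF D] in auto)
  then have "oriented_diam G \<le> digraph_diam ?H"
    unfolding oriented_diam_def by (intro INF_lower) simp
  ultimately have "oriented_diam G \<le> enat (k - d)" by (rule order_trans[rotated])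
  then show ?thesis using \<open>d \<le> k\<close> by (cases "oriented_diam G") auto
qed

section \<open>The bounds for mixed graphs\<close>

context mixed_graph
begin

text \<open>Both \<open>t\<close> and \<open>t'\<close> lie in \<open>A - N\<close>, so a set
  \<open>W\<close> that misses one of them saves a vertex of \<open>A\<close>, which offsets a fifth
  vertex of \<open>N\<close>.\<close>

lemma recoloured_orientation:
  assumes br: "bridgeless G" and bip: "mixed_bipartite G A B" and s: "s \<in> B"
  defines "N \<equiv> {v. {s, v} \<in> medges G}"
  assumes T: "T \<longrightarrow> t \<noteq> t' \<and> (\<forall>z\<in>{t, t'}. (s, z) \<in> marcs G \<or> (z, s) \<in> marcs G)"
  shows "\<exists>D. orients D (traversal G) \<and> (\<forall>x\<in>mverts G. \<forall>y\<in>mverts G. \<exists>W\<subseteq>mverts G.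
    (x, y) \<in> rtrancl_on W D \<and> card (W \<inter> A) + card N \<le> card A + (if T then 4 else 5))"
proof -
  obtain D where D: "orients D (traversal G)" and strong: "\<forall>x\<in>mverts G. \<forall>y\<in>mverts G. (x, y) \<in> D\<^sup>*"
    using br by (rule bridgeless_strong_orientation)
  have sV: "s \<in> mverts G" using s bip by (auto simp: mixed_bipartite_def)
  have NV: "N \<subseteq> mverts G - {s}"
  proof
    fix v assume "v \<in> N"
    then have "{s, v} \<in> medges G" by (simp add: N_def)
    then show "v \<in> mverts G - {s}" using medgeE by blast
  qed
  have AB: "A \<inter> B = {}" "A \<union> B = mverts G" and edges: "\<forall>e\<in>medges G. \<exists>a\<in>A. \<exists>b\<in>B. e = {a, b}"
    and arcs: "marcs G \<subseteq> A \<times> B \<union> B \<times> A"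
    using bip by (simp_all add: mixed_bipartite_def)
  have NA: "N \<subseteq> A"
  proof
    fix v assume "v \<in> N"
    then obtain a b where "a \<in> A" "b \<in> B" "{s, v} = {a, b}" using edges by (auto simp: N_def)
    then show "v \<in> A" using s AB by (auto simp: doubleton_eq_iff)
  qed
  have finA: "finite A" using AB(2) finite_mverts by (metis finite_Un)
  interpret strong_star "mverts G" N s D
  proof
    show "D \<subseteq> mverts G \<times> mverts G" using D traversal_V by (auto simp: orients_def)
    show "D \<inter> D\<inverse> = {}" using D by (simp add: orients_def)
  qed (use finite_mverts sV NV strong in auto)
  have TN: "z \<in> A - N" "(s, z) \<in> D \<or> (z, s) \<in> D"
    if z: "(s, z) \<in> marcs G \<or> (z, s) \<in> marcs G" for z
  proof -
    have "(s, z) \<in> traversal G \<or> (z, s) \<in> traversal G" using z by (auto simp: traversal_def)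
    then show "(s, z) \<in> D \<or> (z, s) \<in> D" using D by (auto simp: orients_def)
    have "{s, z} \<notin> medges G" using z marcs_simple by (metis insert_commute)
    then show "z \<in> A - N" using z arcs s AB by (auto simp: N_def)
  qed
  have "T \<longrightarrow> {t, t'} \<subseteq> mverts G - N \<and> t \<noteq> t' \<and> (\<forall>z\<in>{t, t'}. (s, z) \<in> D \<or> (z, s) \<in> D)"
    using T TN AB by blast
  from respoke_few_N_sym[OF this] obtain M where M: "M \<subseteq> N" and W: "\<forall>x\<in>mverts G. \<forall>y\<in>mverts G. \<exists>W\<subseteq>mverts G.
      (x, y) \<in> rtrancl_on W (respoke s (N - M) M D) \<and>
      (card (W \<inter> N) \<le> 4 \<or> card (W \<inter> N) \<le> 5 \<and> (T \<longrightarrow> \<not> {t, t'} \<subseteq> W))"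
    by (elim exE conjE) (rule that)
  have "orients (respoke s (N - M) M D) (traversal G)"
    using M by (intro respoke_orients[OF D irrefl_traversal]) (auto simp: N_def sym_traversal_iff)
  moreover have "card (W \<inter> A) + card N \<le> card A + (if T then 4 else 5)"
    if W: "card (W \<inter> N) \<le> 4 \<or> card (W \<inter> N) \<le> 5 \<and> (T \<longrightarrow> \<not> {t, t'} \<subseteq> W)" for W
  proof -
    have finN: "finite N" using NA finA finite_subset by blast
    have "card (W \<inter> A) = card (W \<inter> N) + card (W \<inter> A - N)"
      using NA finA finN
      by (subst card_Un_disjoint[symmetric]) (auto intro: arg_cong[where f = card])
    moreover have cA: "card A = card N + card (A - N)"
      using NA finA finN by (simp add: card_Diff_subset card_mono)
    moreover have "card (W \<inter> A - N) \<le> card (A - N)" using finA by (intro card_mono) auto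
    moreover have "card (W \<inter> A - N) < card (A - N)" if "T" "\<not> {t, t'} \<subseteq> W"
    proof (rule psubset_card_mono)
      show "W \<inter> A - N \<subset> A - N" using that T TN by blast
    qed (use finA in auto)
    ultimately show ?thesis using W by (cases T) auto
  qed
  ultimately show ?thesis using W by (intro exI[of _ "respoke s (N - M) M D"]) meson
qed

text \<open>The order is \<open>2 * card A\<close>, and an excess of \<open>k\<close> vertices in
  \<open>A\<close> costs \<open>2 * k\<close> in length, so 5 and 4 give the two bounds.\<close>

lemma oriented_diam_mixed:
  assumes br: "bridgeless G" and bip: "mixed_bipartite G A B" "card A = card B" and s: "s \<in> B"
  shows "oriented_diam G + enat (2 * undirected_degree G s) \<le> enat (card (mverts G) + 10)"
    and "arc_out_degree G s + arc_in_degree G s \<ge> 2 \<Longrightarrow>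
      oriented_diam G + enat (2 * undirected_degree G s) \<le> enat (card (mverts G) + 8)"
proof -
  have "A \<inter> B = {}" "A \<union> B = mverts G" using bip by (simp_all add: mixed_bipartite_def)
  then have n: "card (mverts G) = 2 * card A"
    using bip(2) finite_mverts by (metis card_Un_disjoint finite_Un mult_2)
  let ?N = "{v. {s, v} \<in> medges G}"
  have main: "oriented_diam G + enat (2 * undirected_degree G s) \<le> enat (card (mverts G) + 2 * k)"
    if "orients D (traversal G)" and W: "\<forall>x\<in>mverts G. \<forall>y\<in>mverts G. \<exists>W\<subseteq>mverts G.
      (x, y) \<in> rtrancl_on W D \<and> card (W \<inter> A) + card ?N \<le> card A + k" for D k
  proof (rule oriented_diam_le[OF bip(1) that(1)])
    fix x y assume "x \<in> mverts G" "y \<in> mverts G"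
    then obtain W where "W \<subseteq> mverts G" "(x, y) \<in> rtrancl_on W D" "card (W \<inter> A) + card ?N \<le> card A + k"
      using W by blast
    then show "\<exists>W\<subseteq>mverts G. (x, y) \<in> rtrancl_on W D \<and>
      2 * card (W \<inter> A) + 2 * undirected_degree G s
        \<le> card (mverts G) + 2 * k + of_bool (x \<in> A) + of_bool (y \<in> A)"
      by (intro exI[of _ W]) (simp add: n card_neighbours)
  qed
  obtain D where "orients D (traversal G)" "\<forall>x\<in>mverts G. \<forall>y\<in>mverts G. \<exists>W\<subseteq>mverts G.
      (x, y) \<in> rtrancl_on W D \<and> card (W \<inter> A) + card ?N \<le> card A + 5"
    using recoloured_orientation[OF br bip(1) s, of False] by auto
  from main[OF this] show "oriented_diam G + enat (2 * undirected_degree G s) \<le> enat (card (mverts G) + 10)"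
    by simp
  assume "arc_out_degree G s + arc_in_degree G s \<ge> 2"
  then obtain t t' where "t \<noteq> t'" "(s, t) \<in> marcs G \<or> (t, s) \<in> marcs G" "(s, t') \<in> marcs G \<or> (t', s) \<in> marcs G"
    by (rule two_arcs)
  then obtain D where "orients D (traversal G)" "\<forall>x\<in>mverts G. \<forall>y\<in>mverts G. \<exists>W\<subseteq>mverts G.
      (x, y) \<in> rtrancl_on W D \<and> card (W \<inter> A) + card ?N \<le> card A + 4"
    using recoloured_orientation[OF br bip(1) s, of True t t'] by auto
  from main[OF this] show "oriented_diam G + enat (2 * undirected_degree G s) \<le> enat (card (mverts G) + 8)"
    by simp
qed

end

section \<open>The undirected case\<close>

text \<open>Take \<open>P\<close> maximal among the sets between \<open>I0\<close> and
  \<open>N0\<close> that contain no hyperedge other than singletons. A vertex outside is blocked by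
  a hyperedge that its addition would complete, and this hyperedge meets both sides.\<close>

lemma maximal_independent:
  fixes \<E> :: "'a set set"
  assumes fin: "finite N0" and ne: "{} \<notin> \<E>"
    and I0: "I0 \<subseteq> N0" "\<And>e. e \<in> \<E> \<Longrightarrow> e \<subseteq> I0 \<Longrightarrow> \<exists>w. e = {w}"
  shows "\<exists>P. I0 \<subseteq> P \<and> P \<subseteq> N0 \<and> (\<forall>e\<in>\<E>. e \<subseteq> P \<longrightarrow> (\<exists>w. e = {w})) \<and>
    (\<forall>v\<in>N0 - P. \<exists>e\<in>\<E>. v \<in> e \<and> e \<inter> P \<noteq> {} \<and> e - P \<noteq> {})"
proof -
  define ind where "ind P \<longleftrightarrow> P \<subseteq> N0 \<and> (\<forall>e\<in>\<E>. e \<subseteq> P \<longrightarrow> (\<exists>w. e = {w}))" for P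
  have "finite {P. ind P}" "ind I0"
    using fin I0 by (auto simp: ind_def intro: finite_subset[of _ "Pow N0"])
  then obtain P where P: "ind P" "I0 \<subseteq> P" and max: "\<And>P'. ind P' \<Longrightarrow> P \<subseteq> P' \<Longrightarrow> P' = P"
    using finite_has_maximal2[of "{P. ind P}" I0] by auto
  have "\<exists>e\<in>\<E>. v \<in> e \<and> e \<inter> P \<noteq> {} \<and> e - P \<noteq> {}" if v: "v \<in> N0 - P" for v
  proof -
    have "\<not> ind (insert v P)" using max[of "insert v P"] v by auto
    then obtain e where e: "e \<in> \<E>" "e \<subseteq> insert v P" "\<nexists>w. e = {w}"
      using v P(1) by (auto simp: ind_def)
    then have "v \<in> e" using P(1) by (auto simp: ind_def)
    moreover have "e \<inter> P \<noteq> {}"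
    proof
      assume "e \<inter> P = {}"
      then have "e = {} \<or> e = {v}" using e(2) by blast
      then show False using e(1,3) ne by blast
    qed
    ultimately show ?thesis using e v by blast
  qed
  then show ?thesis using P by (intro exI[of _ P]) (simp add: ind_def)
qed

text \<open>
  Applied to the attachment sets of the components of \<open>G - N - s\<close>. A pair \<open>e\<close>, \<open>f\<close> in the second
  conjunct costs four vertices of \<open>N\<close>, unless a component attached to both ends gives a shortcut; a
  pendant component \<open>{w}\<close> elsewhere contains a vertex of \<open>A\<close> that the path misses.
\<close>

lemma bicolouring_exists:
  fixes \<E> :: "'a set set"
  assumes fin: "finite N" and \<E>: "\<And>e. e \<in> \<E> \<Longrightarrow> e \<subseteq> N" and ne: "{} \<notin> \<E>"
    and cov: "\<And>v. v \<in> N \<Longrightarrow> \<exists>e\<in>\<E>. v \<in> e \<and> e \<noteq> {v}"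
  shows "\<exists>P\<subseteq>N. (\<forall>v\<in>N. \<exists>e\<in>\<E>. v \<in> e \<and> e \<inter> P \<noteq> {} \<and> e - P \<noteq> {}) \<and>
    (\<forall>e\<in>\<E>. \<forall>f\<in>\<E>. e \<subseteq> P \<longrightarrow> f \<inter> P = {} \<longrightarrow>
      (\<exists>z z'. e = {z} \<and> f = {z'} \<and> {z, z'} \<in> \<E>) \<or> (\<exists>w. {w} \<in> \<E> \<and> {w} \<noteq> e \<and> {w} \<noteq> f))"
proof -
  \<comment> \<open>Singleton hyperedges are the attachment sets of pendant components; the case
    split is on their number.\<close>
  define Z where "Z = {w. {w} \<in> \<E>}"
  have ZN: "Z \<subseteq> N" using \<E> by (auto simp: Z_def)
  have covP: "\<exists>e\<in>\<E>. v \<in> e \<and> e \<inter> P \<noteq> {} \<and> e - P \<noteq> {}"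
    if v: "v \<in> N" "v \<in> P" and ind: "\<And>e. e \<in> \<E> \<Longrightarrow> e \<subseteq> P \<Longrightarrow> \<exists>w. e = {w}" for v P
  proof -
    obtain e where e: "e \<in> \<E>" "v \<in> e" "e \<noteq> {v}" using cov[OF v(1)] by blast
    then have "\<not> e \<subseteq> P" using ind by blast
    then show ?thesis using e v by blast
  qed
  have covered: "\<forall>v\<in>N. \<exists>e\<in>\<E>. v \<in> e \<and> e \<inter> P \<noteq> {} \<and> e - P \<noteq> {}"
    if "P \<subseteq> N" "\<forall>e\<in>\<E>. e \<subseteq> P \<longrightarrow> (\<exists>w. e = {w})"
      "\<forall>v\<in>N - P. \<exists>e\<in>\<E>. v \<in> e \<and> e \<inter> P \<noteq> {} \<and> e - P \<noteq> {}" for P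
  proof
    fix v assume "v \<in> N"
    then show "\<exists>e\<in>\<E>. v \<in> e \<and> e \<inter> P \<noteq> {} \<and> e - P \<noteq> {}"
      using covP[of v P] that(2,3) by (cases "v \<in> P") simp_all
  qed
  have witness: ?thesis
    if "P \<subseteq> N" "\<forall>v\<in>N. \<exists>e\<in>\<E>. v \<in> e \<and> e \<inter> P \<noteq> {} \<and> e - P \<noteq> {}"
      "\<And>e f. e \<in> \<E> \<Longrightarrow> f \<in> \<E> \<Longrightarrow> e \<subseteq> P \<Longrightarrow> f \<inter> P = {} \<Longrightarrow>
        (\<exists>z z'. e = {z} \<and> f = {z'} \<and> {z, z'} \<in> \<E>) \<or> (\<exists>w. {w} \<in> \<E> \<and> {w} \<noteq> e \<and> {w} \<noteq> f)" for P
    by (rule exI[of _ P], intro conjI ballI impI) (rule that(1), rule bspec[OF that(2)], assumption, rule that(3))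
  consider (three) a b c where "{a, b, c} \<subseteq> Z" "a \<noteq> b" "a \<noteq> c" "b \<noteq> c"
    | (two) z z' where "Z = {z, z'}" "z \<noteq> z'" "{z, z'} \<notin> \<E>"
    | (edge) z z' where "Z = {z, z'}" "z \<noteq> z'" "{z, z'} \<in> \<E>"
    | (one) z where "Z \<subseteq> {z}" "z \<in> N" | (none) "N = {}"
  proof -
    assume a: thesis if "{a, b, c} \<subseteq> Z" "a \<noteq> b" "a \<noteq> c" "b \<noteq> c" for a b c
    assume b: thesis if "Z = {z, z'}" "z \<noteq> z'" "{z, z'} \<notin> \<E>" for z z'
    assume c: thesis if "Z = {z, z'}" "z \<noteq> z'" "{z, z'} \<in> \<E>" for z z'
    assume d: thesis if "Z \<subseteq> {z}" "z \<in> N" for z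
    assume e: thesis if "N = {}"
    show thesis
    proof (cases "\<exists>z z'. z \<in> Z \<and> z' \<in> Z \<and> z \<noteq> z'")
      case True
      then obtain z z' where z: "z \<in> Z" "z' \<in> Z" "z \<noteq> z'" by blast
      show thesis
      proof (cases "Z = {z, z'}")
        case True
        then show thesis using b c z by blast
      next
        case False
        then obtain w where "w \<in> Z" "w \<noteq> z" "w \<noteq> z'" using z by blast
        then show thesis using a[of z z' w] z by blast
      qed
    next
      case False
      show thesis
      proof (cases "Z = {}")
        case True
        then show thesis using d e by blast
      next
        case Z: False
        then obtain z where "z \<in> Z" by blast
        then show thesis using d[of z] False ZN by blast
      qed
    qed
  qed
  then show ?thesis
  proof cases
    case three
    have "\<exists>w. e = {w}" if "e \<in> \<E>" "e \<subseteq> {}" for e using that ne by auto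
    then have "\<exists>P. {} \<subseteq> P \<and> P \<subseteq> N \<and> (\<forall>e\<in>\<E>. e \<subseteq> P \<longrightarrow> (\<exists>w. e = {w})) \<and>
        (\<forall>v\<in>N - P. \<exists>e\<in>\<E>. v \<in> e \<and> e \<inter> P \<noteq> {} \<and> e - P \<noteq> {})"
      by (intro maximal_independent[OF fin ne]) auto
    then obtain P where P: "{} \<subseteq> P" "P \<subseteq> N" "\<forall>e\<in>\<E>. e \<subseteq> P \<longrightarrow> (\<exists>w. e = {w})"
        "\<forall>v\<in>N - P. \<exists>e\<in>\<E>. v \<in> e \<and> e \<inter> P \<noteq> {} \<and> e - P \<noteq> {}"
      by (elim exE conjE) (rule that)
    \<comment> \<open>Of three distinct singletons, one always differs from both \<open>e\<close>
      and \<open>f\<close>.\<close>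
    have other: "\<exists>w. {w} \<in> \<E> \<and> {w} \<noteq> e \<and> {w} \<noteq> f" for e f
    proof -
      have "\<exists>w\<in>{a, b, c}. {w} \<noteq> e \<and> {w} \<noteq> f"
        using three(2-) by (cases "{a} = e"; cases "{a} = f"; cases "{b} = e"; cases "{b} = f") auto
      then show ?thesis using three(1) unfolding Z_def by blast
    qed
    show ?thesis by (rule witness[OF P(2) covered[OF P(2-4)]]) (intro disjI2 other)
  next
    case two
    \<comment> \<open>Both singletons go into the independent set \<open>I\<close>, and the
      complement serves as the required set. A set \<open>e\<close> inside it is then neither
      singleton, and \<open>f\<close> equals at most one of them.\<close>
    have "\<exists>w. e = {w}" if "e \<in> \<E>" "e \<subseteq> {z, z'}" for e
    proof -
      have "e = {} \<or> e = {z} \<or> e = {z'} \<or> e = {z, z'}" using that(2) by blast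
      then show ?thesis using that(1) ne two(3) by blast
    qed
    then have "\<exists>I. {z, z'} \<subseteq> I \<and> I \<subseteq> N \<and> (\<forall>e\<in>\<E>. e \<subseteq> I \<longrightarrow> (\<exists>w. e = {w})) \<and>
        (\<forall>v\<in>N - I. \<exists>e\<in>\<E>. v \<in> e \<and> e \<inter> I \<noteq> {} \<and> e - I \<noteq> {})"
      using ZN two(1) by (intro maximal_independent[OF fin ne]) auto
    then obtain I where I: "{z, z'} \<subseteq> I" "I \<subseteq> N" "\<forall>e\<in>\<E>. e \<subseteq> I \<longrightarrow> (\<exists>w. e = {w})"
        "\<forall>v\<in>N - I. \<exists>e\<in>\<E>. v \<in> e \<and> e \<inter> I \<noteq> {} \<and> e - I \<noteq> {}"
      by (elim exE conjE) (rule that)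
    have cov': "\<exists>e\<in>\<E>. v \<in> e \<and> e \<inter> (N - I) \<noteq> {} \<and> e - (N - I) \<noteq> {}" if v: "v \<in> N" for v
    proof -
      obtain e where "e \<in> \<E>" "v \<in> e" "e \<inter> I \<noteq> {}" "e - I \<noteq> {}"
        using covered[OF I(2-4)] v by blast
      then show ?thesis using \<E>[of e] by (intro bexI[of _ e]) auto
    qed
    have other: "\<exists>w. {w} \<in> \<E> \<and> {w} \<noteq> e \<and> {w} \<noteq> f" if "e \<subseteq> N - I" for e f
    proof -
      have "{z} \<in> \<E>" "{z'} \<in> \<E>" using two(1) by (auto simp: Z_def)
      moreover have "{z} \<noteq> e" "{z'} \<noteq> e" using that I(1) by auto
      moreover have "{z} \<noteq> f \<or> {z'} \<noteq> f" using two(2) by auto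
      ultimately show ?thesis by blast
    qed
    show ?thesis by (rule witness[of "N - I"]) (use cov' other in auto)
  next
    case edge
    \<comment> \<open>The seed is \<open>z\<close> alone: the hyperedge \<open>{z, z'}\<close> keeps
      \<open>z'\<close> out of \<open>P\<close>, so \<open>e\<close> must be \<open>{z}\<close>.
      Then \<open>f = {z'}\<close> gives the first alternative, and any other \<open>f\<close>
      leaves \<open>z'\<close> as the witness.\<close>
    have "\<exists>w. e = {w}" if "e \<in> \<E>" "e \<subseteq> {z}" for e using that ne by (metis subset_singletonD)
    then have "\<exists>P. {z} \<subseteq> P \<and> P \<subseteq> N \<and> (\<forall>e\<in>\<E>. e \<subseteq> P \<longrightarrow> (\<exists>w. e = {w})) \<and>
        (\<forall>v\<in>N - P. \<exists>e\<in>\<E>. v \<in> e \<and> e \<inter> P \<noteq> {} \<and> e - P \<noteq> {})"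
      using ZN edge(1) by (intro maximal_independent[OF fin ne]) auto
    then obtain P where P: "{z} \<subseteq> P" "P \<subseteq> N" "\<forall>e\<in>\<E>. e \<subseteq> P \<longrightarrow> (\<exists>w. e = {w})"
        "\<forall>v\<in>N - P. \<exists>e\<in>\<E>. v \<in> e \<and> e \<inter> P \<noteq> {} \<and> e - P \<noteq> {}"
      by (elim exE conjE) (rule that)
    have "z' \<notin> P" using P(1) bspec[OF P(3) edge(3)] edge(2) by auto
    have other: "(\<exists>z z'. e = {z} \<and> f = {z'} \<and> {z, z'} \<in> \<E>) \<or> (\<exists>w. {w} \<in> \<E> \<and> {w} \<noteq> e \<and> {w} \<noteq> f)"
      if e: "e \<in> \<E>" "f \<in> \<E>" "e \<subseteq> P" "f \<inter> P = {}" for e f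
    proof -
      obtain w where "e = {w}" using P(3) e by blast
      then have "w \<in> Z" "w \<in> P" using e by (auto simp: Z_def)
      then have "e = {z}" using \<open>e = {w}\<close> edge(1) \<open>z' \<notin> P\<close> by auto
      moreover have "{z'} \<in> \<E>" using edge(1) by (auto simp: Z_def)
      ultimately show ?thesis using edge(2,3) by (cases "f = {z'}") auto
    qed
    show ?thesis by (rule witness[OF P(2) covered[OF P(2-4)]]) (rule other)
  next
    case one
    \<comment> \<open>Keeping \<open>z\<close> out of \<open>P\<close> excludes the only possible
      singleton, so no hyperedge lies in \<open>P\<close> and the second conjunct is vacuous. The
      seed \<open>v\<close> shares \<open>e0\<close> with \<open>z\<close>, which keeps
      \<open>z\<close> covered.\<close>
    obtain e0 where e0: "e0 \<in> \<E>" "z \<in> e0" "e0 \<noteq> {z}" using cov one by blast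
    then obtain v where v: "v \<in> e0" "v \<noteq> z" by blast
    have vN: "{v} \<subseteq> N - {z}" using v \<E> e0 by auto
    have "\<exists>w. e = {w}" if "e \<in> \<E>" "e \<subseteq> {v}" for e using that ne by (metis subset_singletonD)
    then have "\<exists>P. {v} \<subseteq> P \<and> P \<subseteq> N - {z} \<and> (\<forall>e\<in>\<E>. e \<subseteq> P \<longrightarrow> (\<exists>w. e = {w})) \<and>
        (\<forall>v\<in>N - {z} - P. \<exists>e\<in>\<E>. v \<in> e \<and> e \<inter> P \<noteq> {} \<and> e - P \<noteq> {})"
      using vN by (intro maximal_independent[OF finite_Diff[OF fin] ne]) auto
    then obtain P where P: "{v} \<subseteq> P" "P \<subseteq> N - {z}" "\<forall>e\<in>\<E>. e \<subseteq> P \<longrightarrow> (\<exists>w. e = {w})"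
        "\<forall>v\<in>N - {z} - P. \<exists>e\<in>\<E>. v \<in> e \<and> e \<inter> P \<noteq> {} \<and> e - P \<noteq> {}"
      by (elim exE conjE) (rule that)
    have cov': "\<exists>e\<in>\<E>. u \<in> e \<and> e \<inter> P \<noteq> {} \<and> e - P \<noteq> {}" if "u \<in> N" for u
    proof -
      consider "u = z" | "u \<in> P" | "u \<in> N - {z} - P" using \<open>u \<in> N\<close> by blast
      then show ?thesis
      proof cases
        case 1
        then show ?thesis using e0 v P(1,2) by (intro bexI[of _ e0]) auto
      qed (use covP[of u P] P(3,4) that in blast)+
    qed
    have other: "\<not> e \<subseteq> P" if e: "e \<in> \<E>" for e
    proof
      assume "e \<subseteq> P"
      then obtain w where "e = {w}" using P(3) e by blast
      then have "w \<in> Z" "w \<in> P" using e \<open>e \<subseteq> P\<close> by (auto simp: Z_def)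
      then show False using one(1) P(2) by auto
    qed
    show ?thesis by (rule witness[of P]) (use P(2) cov' other in auto)
  next
    case none
    have "\<E> = {}" using \<E> ne none by (metis all_not_in_conv subset_empty)
    then show ?thesis using none by auto
  qed
qed

section \<open>Components around a vertex of an undirected bipartite graph\<close>

locale bipartite_star =
  fixes A B :: "'a set" and R :: "'a rel" and s :: 'a
  assumes finite_AB: "finite A" "finite B"
    and disj: "A \<inter> B = {}"
    and R_AB: "R \<subseteq> A \<times> B \<union> B \<times> A"
    and sym_R: "sym R"
    and s_B: "s \<in> B"
    and strong: "\<And>x y. x \<in> A \<union> B \<Longrightarrow> y \<in> A \<union> B \<Longrightarrow> (x, y) \<in> R\<^sup>*"
    and no_bridge: "\<And>x y. (x, y) \<in> R \<Longrightarrow> (x, y) \<in> (R - {(x, y), (y, x)})\<^sup>*"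
begin

definition N :: "'a set" where "N = {v. (s, v) \<in> R}"
definition U :: "'a set" where "U = A \<union> B - N - {s}"
text \<open>As \<open>R\<close> is symmetric, this is a component of the graph without
  \<open>s\<close> and \<open>N\<close>. It is empty for \<open>q\<close> outside \<open>U\<close>,
  so \<open>comp x\<close> can be written for every vertex.\<close>

definition comp :: "'a \<Rightarrow> 'a set" where "comp q = {x. (q, x) \<in> rtrancl_on U R}"
definition att :: "'a \<Rightarrow> 'a set" where "att q = {v \<in> N. \<exists>x\<in>comp q. (x, v) \<in> R}"
definition mixed :: "'a set \<Rightarrow> 'a set" where
  "mixed P = {q \<in> U. att q \<inter> P \<noteq> {} \<and> att q - P \<noteq> {}}"

lemma R_sym: "(x, y) \<in> R \<longleftrightarrow> (y, x) \<in> R"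
  using sym_R by (auto simp: sym_def)

lemma N_A: "N \<subseteq> A"
  using R_AB disj s_B by (auto simp: N_def)

lemma s_notin: "s \<notin> N" "s \<notin> U"
  using N_A s_B disj by (auto simp: U_def)

lemma N_U: "N \<inter> U = {}"
  by (auto simp: U_def)

lemma V_cases: "x \<in> A \<union> B \<Longrightarrow> x = s \<or> x \<in> N \<or> x \<in> U"
  by (auto simp: U_def)

lemma U_not_s: "x \<in> U \<Longrightarrow> (x, s) \<notin> R"
  using R_sym[of x s] by (simp add: U_def N_def)

lemma R_mem: "(x, y) \<in> R \<Longrightarrow> x \<in> A \<union> B \<and> y \<in> A \<union> B"
  using R_AB by auto

lemma comp_U: "comp q \<subseteq> U"
  using in_rtrancl_on_in_F(2)[of q _ U R] by (auto simp: comp_def)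

lemma comp_refl: "q \<in> U \<Longrightarrow> q \<in> comp q"
  by (simp add: comp_def)

lemma comp_step: "x \<in> comp q \<Longrightarrow> (x, y) \<in> R \<Longrightarrow> y \<in> U \<Longrightarrow> y \<in> comp q"
  using comp_U unfolding comp_def by (auto intro: rtrancl_on_into_rtrancl_on)

lemma comp_eq:
  assumes "x \<in> comp q" shows "comp x = comp q"
proof -
  have "(q, x) \<in> rtrancl_on U R" "(x, q) \<in> rtrancl_on U R"
    using assms rtrancl_on_sym[OF sym_R] by (auto simp: comp_def sym_def)
  then show ?thesis unfolding comp_def by (blast intro: rtrancl_on_trans)
qed

lemma att_eq: "x \<in> comp q \<Longrightarrow> att x = att q"
  using comp_eq by (simp add: att_def)

lemma att_N: "att q \<subseteq> N"
  by (auto simp: att_def)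

lemma mixed_comp: "q \<in> mixed P \<Longrightarrow> comp q \<subseteq> mixed P"
  using att_eq comp_U unfolding mixed_def by blast

lemma mixed_compl: "mixed (N - P) = mixed P"
  using att_N unfolding mixed_def by blast

text \<open>Vertices of \<open>U\<close> are not adjacent to \<open>s\<close>, and a step within
  \<open>U\<close> stays in the component, so the first exit is at an attachment vertex.\<close>

lemma leave_comp:
  assumes D: "D \<subseteq> R" and q: "q \<in> U" and qs: "(q, s) \<in> D\<^sup>*"
  obtains a v where "(q, a) \<in> rtrancl_on (comp q) D" "a \<in> comp q" "(a, v) \<in> D" "v \<in> att q"
proof -
  have "q \<in> A \<union> B" using q by (auto simp: U_def)
  then have "(q, s) \<in> rtrancl_on (A \<union> B) D"
    using qs s_B D R_AB by (intro rtrancl_imp_rtrancl_on) auto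
  then obtain a b where ab: "(q, a) \<in> rtrancl_on ((A \<union> B) \<inter> comp q) D" "(a, b) \<in> D" "b \<in> A \<union> B - comp q"
    by (rule rtrancl_on_exitE[of q s "A \<union> B" D "comp q"]) (use comp_refl[OF q] comp_U s_notin in auto)
  have a: "a \<in> comp q" using in_rtrancl_on_in_F(2)[OF ab(1)] by simp
  then have "a \<in> U" using comp_U by auto
  then have "b \<noteq> s" using U_not_s ab(2) D by auto
  moreover have "b \<notin> U" using comp_step[OF a] ab(2,3) D by auto
  ultimately have "b \<in> N" using ab(3) V_cases by auto
  then have "b \<in> att q" using a ab(2) D by (auto simp: att_def)
  then show ?thesis using that[OF _ a ab(2)] rtrancl_on_mono[OF subset_refl _ ab(1), of "comp q"] by auto
qed

lemma att_nonempty: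
  assumes "q \<in> U" shows "att q \<noteq> {}"
proof -
  have "(q, s) \<in> R\<^sup>*" using assms s_B strong by (auto simp: U_def)
  from leave_comp[OF subset_refl assms this] show ?thesis by blast
qed

text \<open>Otherwise \<open>v\<close> with all components adjacent to it could be left only along
  the edge from \<open>v\<close> to \<open>s\<close>, which would be a bridge.\<close>

lemma touches_two:
  assumes v: "v \<in> N"
  obtains q where "q \<in> U" "(v, q) \<in> R" "v \<in> att q" "att q \<noteq> {v}"
proof -
  define X where "X = insert v (\<Union>{comp q | q. q \<in> U \<and> (v, q) \<in> R})"
  have vs: "(v, s) \<in> R" using v R_sym[of v s] by (simp add: N_def)
  have sX: "s \<notin> X" using s_notin comp_U v by (auto simp: X_def)
  have "\<exists>a b. a \<in> X \<and> b \<notin> X \<and> (a, b) \<in> R - {(v, s), (s, v)}"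
  proof (rule ccontr)
    assume neg: "\<not> ?thesis"
    define E where "E = R - {(v, s), (s, v)}"
    have "(v, s) \<in> E\<^sup>*" using no_bridge[OF vs] by (simp add: E_def)
    then have "s \<in> X"
      by (induction rule: rtrancl_induct) (use neg in \<open>auto simp: E_def X_def\<close>)
    then show False using sX by simp
  qed
  then obtain a b where ab: "a \<in> X" "b \<notin> X" "(a, b) \<in> R" "(a, b) \<noteq> (v, s)" by blast
  \<comment> \<open>The other neighbours of \<open>v\<close> lie in \<open>B\<close>, hence in
    \<open>U\<close> because \<open>N \<subseteq> A\<close>, so their components are already part of
    \<open>X\<close>.\<close>
  have "a \<noteq> v"
  proof
    assume "a = v"
    then have "b \<noteq> s" "b \<in> B" using ab v N_A R_AB disj by auto
    then have "b \<in> U" using N_A disj by (auto simp: U_def)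
    then have "comp b \<subseteq> X" "b \<in> comp b"
      using ab(3) \<open>a = v\<close> comp_refl by (auto simp: X_def)
    then show False using ab(2) by auto
  qed
  then obtain q where q: "q \<in> U" "(v, q) \<in> R" "a \<in> comp q" using ab(1) by (auto simp: X_def)
  then have "comp q \<subseteq> X" by (auto simp: X_def)
  then have "b \<notin> U" using comp_step[OF q(3) ab(3)] ab(2) by auto
  moreover have "b \<noteq> s" using U_not_s q(3) comp_U ab(3) by auto
  ultimately have "b \<in> N" using V_cases R_mem[OF ab(3)] by auto
  then have "b \<in> att q" using q(3) ab(3) by (auto simp: att_def)
  moreover have "b \<noteq> v" using ab(2) by (auto simp: X_def)
  moreover have "v \<in> att q" using q(2) v comp_refl[OF q(1)] R_sym[of v q] by (auto simp: att_def)
  ultimately show ?thesis using that q by auto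
qed

text \<open>A vertex of \<open>B\<close> has all its neighbours in \<open>A\<close>. If
  \<open>z\<close> were the only one, the edge to \<open>z\<close> would be a bridge.\<close>

lemma pendant_meets_A:
  assumes q: "q \<in> U" and z: "att q = {z}"
  shows "comp q \<inter> A \<noteq> {}"
proof (cases "q \<in> A")
  case True
  then show ?thesis using comp_refl[OF q] by auto
next
  case False
  then have qB: "q \<in> B" using q by (auto simp: U_def)
  have step: "b \<in> comp q \<inter> A \<or> b = z" if b: "(q, b) \<in> R" for b
  proof -
    have "b \<in> A" using b qB R_AB disj by auto
    then consider "b \<in> N" | "b \<in> U" using s_B disj by (auto simp: U_def)
    then show ?thesis
    proof cases
      case 1
      then have "b \<in> att q" using comp_refl[OF q] b by (auto simp: att_def)
      then show ?thesis using z by auto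
    next
      case 2
      then show ?thesis using comp_step[OF comp_refl[OF q] b] \<open>b \<in> A\<close> by auto
    qed
  qed
  have "q \<noteq> s" "(q, s) \<in> R\<^sup>*" using q s_notin qB s_B strong by auto
  then obtain b where b: "(q, b) \<in> R" by (meson converse_rtranclE)
  show ?thesis
  proof (cases "b = z")
    case True
    have "(q, z) \<in> (R - {(q, z), (z, q)})\<^sup>*" using no_bridge b True by blast
    moreover have "z \<in> A" using z att_N[of q] N_A by auto
    then have "q \<noteq> z" using qB disj by auto
    ultimately obtain c where "(q, c) \<in> R" "c \<noteq> z" by (blast elim: converse_rtranclE)
    then show ?thesis using step by auto
  qed (use step b in auto)
qed

text \<open>No arc returns from a mixed component to \<open>P\<close>, so a mixed vertex leaves its
  component at some \<open>m \<in> N - P\<close>, one arc before \<open>s\<close>. A start in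
  \<open>P\<close>, or attached only to \<open>P\<close>, first spends a vertex of \<open>P\<close>.
  Stating this for any such \<open>D\<close> and \<open>P\<close> allows reuse for reversed arcs
  with \<open>N - P\<close>.\<close>

lemma leave:
  assumes D: "D \<subseteq> R" and PN: "P \<subseteq> N" and Ds: "\<And>x. x \<in> A \<union> B \<Longrightarrow> (x, s) \<in> D\<^sup>*"
    and valid: "\<And>v. v \<in> N \<Longrightarrow> \<exists>q\<in>mixed P. (v, q) \<in> R"
    and Ms: "\<And>m. m \<in> N - P \<Longrightarrow> (m, s) \<in> D"
    and PX: "\<And>p q. p \<in> P \<Longrightarrow> q \<in> mixed P \<Longrightarrow> (p, q) \<in> R \<Longrightarrow> (p, q) \<in> D"
    and XP: "\<And>p q. p \<in> P \<Longrightarrow> q \<in> mixed P \<Longrightarrow> (q, p) \<notin> D"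
    and x: "x \<in> A \<union> B"
  shows "\<exists>S\<subseteq>N. (x, s) \<in> rtrancl_on (insert s (mixed P) \<union> comp x \<union> S) D \<and> card S \<le> 2 \<and>
    (x \<notin> P \<longrightarrow> \<not> (x \<in> U \<and> att x \<subseteq> P) \<longrightarrow> card S \<le> 1)"
proof -
  have UV: "U \<subseteq> A \<union> B" by (auto simp: U_def)
  have exitM: "\<exists>m\<in>N - P. (q, s) \<in> rtrancl_on (insert s (mixed P) \<union> {m}) D" if q: "q \<in> mixed P" for q
  proof -
    have qU: "q \<in> U" using q by (simp add: mixed_def)
    obtain a v where av: "(q, a) \<in> rtrancl_on (comp q) D" "a \<in> comp q" "(a, v) \<in> D" "v \<in> att q"
      using leave_comp[OF D qU] Ds qU UV by blast
    have "a \<in> mixed P" using mixed_comp[OF q] av(2) by auto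
    then have v: "v \<in> N - P" using XP av(3,4) att_N by blast
    have "(q, v) \<in> rtrancl_on (insert s (mixed P) \<union> {v}) D"
      by (rule rtrancl_on_snoc[OF av(1,3)]) (use mixed_comp[OF q] in auto)
    then have "(q, s) \<in> rtrancl_on (insert s (mixed P) \<union> {v}) D"
      by (rule rtrancl_on_snoc[OF _ Ms[OF v]]) auto
    then show ?thesis using v by blast
  qed
  have via: "\<exists>S\<subseteq>N. v \<in> S \<and> (v, s) \<in> rtrancl_on (insert s (mixed P) \<union> S) D \<and> card S \<le> 2 \<and>
      (v \<notin> P \<longrightarrow> card S \<le> 1)" if v: "v \<in> N" for v
  proof (cases "v \<in> P")
    case True
    obtain q where q: "q \<in> mixed P" "(v, q) \<in> R" using valid[OF v] by blast
    obtain m where m: "m \<in> N - P" "(q, s) \<in> rtrancl_on (insert s (mixed P) \<union> {m}) D"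
      using exitM[OF q(1)] by blast
    have "(v, s) \<in> rtrancl_on (insert s (mixed P) \<union> {v, m}) D"
      by (rule rtrancl_on_Cons[OF PX[OF True q] m(2)]) auto
    then show ?thesis using v m True by (intro exI[of _ "{v, m}"]) (auto simp: card_insert_if)
  next
    case False
    have "(v, s) \<in> rtrancl_on (insert s (mixed P) \<union> {v}) D"
      by (rule rtrancl_on_snoc[OF rtrancl_on_refl Ms, of v "{v}"]) (use v False in auto)
    then show ?thesis using v by (intro exI[of _ "{v}"]) auto
  qed
  consider "x = s" | "x \<in> N" | "x \<in> mixed P" | "x \<in> U - mixed P" using V_cases[OF x] by blast
  then show ?thesis
  proof cases
    case 1
    then show ?thesis by (intro exI[of _ "{}"]) auto
  next
    case 2
    obtain S where S: "S \<subseteq> N" "(x, s) \<in> rtrancl_on (insert s (mixed P) \<union> S) D" "card S \<le> 2"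
      "x \<notin> P \<longrightarrow> card S \<le> 1"
      using via[OF 2] by blast
    have "(x, s) \<in> rtrancl_on (insert s (mixed P) \<union> comp x \<union> S) D"
      by (rule rtrancl_on_mono[OF subset_refl _ S(2)]) auto
    then show ?thesis using S by (intro exI[of _ S]) simp
  next
    case 3
    obtain m where m: "m \<in> N - P" "(x, s) \<in> rtrancl_on (insert s (mixed P) \<union> {m}) D"
      using exitM[OF 3] by blast
    have "(x, s) \<in> rtrancl_on (insert s (mixed P) \<union> comp x \<union> {m}) D"
      by (rule rtrancl_on_mono[OF subset_refl _ m(2)]) auto
    then show ?thesis using m by (intro exI[of _ "{m}"]) simp
  next
    case 4
    then have xU: "x \<in> U" by simp
    obtain a v where av: "(x, a) \<in> rtrancl_on (comp x) D" "a \<in> comp x" "(a, v) \<in> D" "v \<in> att x"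
      using leave_comp[OF D xU] Ds xU UV by blast
    have v: "v \<in> N" using av(4) att_N by auto
    obtain S where S: "S \<subseteq> N" "v \<in> S" "(v, s) \<in> rtrancl_on (insert s (mixed P) \<union> S) D" "card S \<le> 2"
      "v \<notin> P \<longrightarrow> card S \<le> 1"
      using via[OF v] by blast
    have "(x, v) \<in> rtrancl_on (comp x \<union> {v}) D"
      by (rule rtrancl_on_snoc[OF av(1,3)]) auto
    then have "(x, s) \<in> rtrancl_on (insert s (mixed P) \<union> comp x \<union> S) D"
      by (rule rtrancl_on_join[OF _ S(3)]) (use S(2) in auto)
    moreover have "att x \<subseteq> P" if "v \<in> P" using 4 that av(4) by (auto simp: mixed_def)
    ultimately show ?thesis using S xU by (intro exI[of _ S]) blast
  qed
qed

text \<open>The prescribed directions are harmless: every deleted arc has a replacement route, and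
  the underlying graph is unchanged, so a strong orientation exists. The exceptional pairs may need
  2 + 2 vertices of \<open>N\<close>, unless a component attached to exactly \<open>z\<close> and
  \<open>z'\<close> bypasses \<open>s\<close>.\<close>

lemma partition_orientation:
  assumes PN: "P \<subseteq> N" and valid: "\<And>v. v \<in> N \<Longrightarrow> \<exists>q\<in>mixed P. (v, q) \<in> R"
  obtains D where "orients D R" and "\<And>x y. x \<in> A \<union> B \<Longrightarrow> y \<in> A \<union> B \<Longrightarrow>
    \<exists>S\<subseteq>N. (x, y) \<in> rtrancl_on (insert s (mixed P) \<union> comp x \<union> comp y \<union> S) D \<and> card S \<le> 4 \<and>
      (x \<notin> N \<longrightarrow> y \<notin> N \<longrightarrow>
        \<not> (x \<in> U \<and> y \<in> U \<and> att x \<subseteq> P \<and> att y \<inter> P = {} \<and>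
          \<not> (\<exists>z z'. \<exists>q\<in>U. att x = {z} \<and> att y = {z'} \<and> att q = {z, z'})) \<longrightarrow> card S \<le> 3)"
proof -
  define X where "X = mixed P"
  \<comment> \<open>The remaining directions lead from \<open>s\<close> to \<open>P\<close>, into
    the mixed components, out to \<open>N - P\<close> and back to \<open>s\<close>.\<close>
  define R' where "R' = R - (P \<times> {s} \<union> {s} \<times> (N - P) \<union> X \<times> P \<union> (N - P) \<times> X)"
  have XU: "X \<subseteq> U" by (auto simp: X_def mixed_def)
  have NX: "N \<inter> X = {}" "s \<notin> X" using XU N_U s_notin by auto
  have sN: "(s, v) \<in> R \<longleftrightarrow> v \<in> N" "(v, s) \<in> R \<longleftrightarrow> v \<in> N" for v
    using R_sym[of v s] by (auto simp: N_def)
  \<comment> \<open>Arcs inside a component are untouched, and a mixed component has attachments on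
    both sides, so it can be left towards \<open>N - P\<close> and entered from
    \<open>P\<close>.\<close>
  have to_s: "(q, s) \<in> R'\<^sup>*" and from_s: "(s, q) \<in> R'\<^sup>*" if q: "q \<in> X" for q
  proof -
    have sub: "rtrancl_on U R \<subseteq> R'\<^sup>*"
    proof
      fix e assume "e \<in> rtrancl_on U R"
      then obtain a b where e: "e = (a, b)" "(a, b) \<in> rtrancl_on U R" by (cases e) auto
      have "(a, b) \<in> rtrancl_on U R'"
        by (rule rtrancl_on_subset[OF e(2)]) (use PN N_U s_notin in \<open>auto simp: R'_def\<close>)
      then show "e \<in> R'\<^sup>*" using e(1) rtrancl_on_rtranclI by metis
    qed
    obtain p m where p: "p \<in> att q \<inter> P" and m: "m \<in> att q - P"
      using q by (auto simp: X_def mixed_def)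
    obtain x where x: "x \<in> comp q" "(x, m) \<in> R" using m by (auto simp: att_def)
    obtain y where y: "y \<in> comp q" "(y, p) \<in> R" using p by (auto simp: att_def)
    have xy: "x \<in> X" "y \<in> X" using x y mixed_comp q by (auto simp: X_def)
    have pm: "p \<in> N" "m \<in> N" using p m att_N by auto
    have "(q, x) \<in> R'\<^sup>*" using x(1) sub by (auto simp: comp_def)
    moreover have "(x, m) \<in> R'" using x m pm xy NX PN s_notin by (auto simp: R'_def)
    moreover have "(m, s) \<in> R'" using m pm NX s_notin PN by (auto simp: R'_def sN)
    ultimately show "(q, s) \<in> R'\<^sup>*" by (meson rtrancl.rtrancl_into_rtrancl)
    have "(y, q) \<in> rtrancl_on U R"
      using y(1) rtrancl_on_sym[OF sym_R] by (auto simp: comp_def sym_def)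
    then have "(y, q) \<in> R'\<^sup>*" using sub by auto
    moreover have "(p, y) \<in> R'"
      using y p pm xy NX PN s_notin R_sym[of p y] by (auto simp: R'_def)
    moreover have "(s, p) \<in> R'" using p pm NX s_notin PN by (auto simp: R'_def sN)
    ultimately show "(s, q) \<in> R'\<^sup>*" by (meson converse_rtrancl_into_rtrancl)
  qed
  have P_s: "(p, s) \<in> R'\<^sup>*" "(s, p) \<in> R'" if p: "p \<in> P" for p
  proof -
    obtain q where q: "q \<in> X" "(p, q) \<in> R" using valid[of p] p PN by (auto simp: X_def)
    then have "(p, q) \<in> R'" using p PN NX s_notin by (auto simp: R'_def)
    then show "(p, s) \<in> R'\<^sup>*" using to_s[OF q(1)] by (rule converse_rtrancl_into_rtrancl)
    show "(s, p) \<in> R'" using p PN NX s_notin by (auto simp: R'_def sN)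
  qed
  have M_s: "(s, m) \<in> R'\<^sup>*" "(m, s) \<in> R'" if m: "m \<in> N - P" for m
  proof -
    obtain q where q: "q \<in> X" "(m, q) \<in> R" using valid[of m] m by (auto simp: X_def)
    then have "(q, m) \<in> R'" using m PN NX s_notin R_sym[of m q] by (auto simp: R'_def)
    with from_s[OF q(1)] show "(s, m) \<in> R'\<^sup>*" by (rule rtrancl_into_rtrancl)
    show "(m, s) \<in> R'" using m PN NX s_notin by (auto simp: R'_def sN)
  qed
  have "R \<subseteq> R'\<^sup>*"
  proof
    fix e assume e: "e \<in> R"
    then consider "e \<in> R'" | p where "e = (p, s)" "p \<in> P" | m where "e = (s, m)" "m \<in> N - P"
      | q p where "e = (q, p)" "q \<in> X" "p \<in> P" | m q where "e = (m, q)" "q \<in> X" "m \<in> N - P"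
      unfolding R'_def by blast
    then show "e \<in> R'\<^sup>*"
    proof cases
      case 4
      have "(s, p) \<in> R'" "(q, s) \<in> R'\<^sup>*" using 4 P_s to_s by auto
      then show ?thesis using 4(1) by (auto intro: rtrancl_into_rtrancl)
    next
      case 5
      have "(m, s) \<in> R'" "(s, q) \<in> R'\<^sup>*" using 5 M_s from_s by auto
      then show ?thesis using 5(1) by (auto intro: converse_rtrancl_into_rtrancl)
    qed (use P_s M_s in auto)
  qed
  then have strong': "(a, b) \<in> R'\<^sup>*" if "a \<in> A \<union> B" "b \<in> A \<union> B" for a b
    using rtrancl_subset_rtranclI[OF strong[OF that]] by blast
  have und: "R' \<union> R'\<inverse> = R"
  proof (rule set_eqI, clarify)
    fix a b
    show "(a, b) \<in> R' \<union> R'\<inverse> \<longleftrightarrow> (a, b) \<in> R"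
      using R_sym[of a b] PN NX s_notin by (auto simp: R'_def)
  qed
  have "\<exists>D\<subseteq>R'. R' \<subseteq> D \<union> D\<inverse> \<and> D \<inter> D\<inverse> = {} \<and> (\<forall>a\<in>A \<union> B. \<forall>b\<in>A \<union> B. (a, b) \<in> D\<^sup>*)"
  proof (rule strong_orientation_exists)
    show "finite R'"
      using finite_AB R_AB by (intro finite_subset[of R' "(A \<union> B) \<times> (A \<union> B)"]) (auto simp: R'_def)
    show "R' \<subseteq> (A \<union> B) \<times> (A \<union> B)" using R_AB by (auto simp: R'_def)
    show "irrefl R'" using R_AB disj by (auto simp: R'_def irrefl_def)
    show "(x, y) \<in> (R' \<union> R'\<inverse> - {(x, y), (y, x)})\<^sup>*" if "(x, y) \<in> R'" for x y
      unfolding und using that by (intro no_bridge) (simp add: R'_def)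
  qed (rule strong')
  then obtain D where D: "D \<subseteq> R'" "R' \<subseteq> D \<union> D\<inverse>" "D \<inter> D\<inverse> = {}"
    and Dstrong: "\<forall>a\<in>A \<union> B. \<forall>b\<in>A \<union> B. (a, b) \<in> D\<^sup>*"
    by (elim exE conjE) (rule that)
  have DR: "D \<subseteq> R" "D\<inverse> \<subseteq> R" using D(1) und by auto
  have into: "(a, b) \<in> D" if "(a, b) \<in> R" "(b, a) \<notin> R'" for a b
    using that D(1,2) und by blast
  have facts: "m \<in> N - P \<Longrightarrow> (m, s) \<in> D" "p \<in> P \<Longrightarrow> (s, p) \<in> D"
    "p \<in> P \<Longrightarrow> q \<in> X \<Longrightarrow> (p, q) \<in> R \<Longrightarrow> (p, q) \<in> D" "p \<in> P \<Longrightarrow> q \<in> X \<Longrightarrow> (q, p) \<notin> D"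
    "m \<in> N - P \<Longrightarrow> q \<in> X \<Longrightarrow> (q, m) \<in> R \<Longrightarrow> (q, m) \<in> D" "m \<in> N - P \<Longrightarrow> q \<in> X \<Longrightarrow> (m, q) \<notin> D" for m p q
    using D(1) into[of m s] into[of s p] into[of p q] into[of q m] PN sN by (auto simp: R'_def)
  have leave': "\<exists>S\<subseteq>N. (x, s) \<in> rtrancl_on (insert s X \<union> comp x \<union> S) D \<and> card S \<le> 2 \<and>
    (x \<notin> P \<longrightarrow> \<not> (x \<in> U \<and> att x \<subseteq> P) \<longrightarrow> card S \<le> 1)" if "x \<in> A \<union> B" for x
    unfolding X_def
    by (rule leave[OF DR(1) PN _ valid _ _ _ that])
      (use Dstrong s_B facts in \<open>auto simp: X_def\<close>)
  \<comment> \<open>Arriving is leaving in the converse of \<open>D\<close> with \<open>P\<close>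
    and \<open>N - P\<close> exchanged; both give the same mixed vertices.\<close>
  have arrive': "\<exists>S\<subseteq>N. (s, y) \<in> rtrancl_on (insert s X \<union> comp y \<union> S) D \<and> card S \<le> 2 \<and>
    (y \<notin> N - P \<longrightarrow> \<not> (y \<in> U \<and> att y \<subseteq> N - P) \<longrightarrow> card S \<le> 1)" if y: "y \<in> A \<union> B" for y
    unfolding rtrancl_on_converse[of y s _ D, symmetric] X_def mixed_compl[of P, symmetric]
  proof (rule leave[OF DR(2) _ _ _ _ _ _ y])
    show "(x, s) \<in> (D\<inverse>)\<^sup>*" if "x \<in> A \<union> B" for x
      using Dstrong s_B that by (auto simp: rtrancl_converse)
    show "\<exists>q\<in>mixed (N - P). (v, q) \<in> R" if "v \<in> N" for v
      using valid[OF that] by (simp add: mixed_compl)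
    show "(p, q) \<in> D\<inverse>" if "p \<in> N - P" "q \<in> mixed (N - P)" "(p, q) \<in> R" for p q
      using facts(5)[of p q] that R_sym[of p q] by (simp add: mixed_compl X_def)
    show "(q, p) \<notin> D\<inverse>" if "p \<in> N - P" "q \<in> mixed (N - P)" for p q
      using facts(6)[of p q] that by (simp add: mixed_compl X_def)
  qed (use facts PN in auto)
  show ?thesis
  proof (rule that)
    show "orients D R" using D DR und by (auto simp: orients_def)
  next
    fix x y assume xy: "x \<in> A \<union> B" "y \<in> A \<union> B"
    let ?W = "insert s X \<union> comp x \<union> comp y"
    have "\<exists>S\<subseteq>N. (x, y) \<in> rtrancl_on (?W \<union> S) D \<and> card S \<le> 4 \<and>
      (x \<notin> N \<longrightarrow> y \<notin> N \<longrightarrow>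
        \<not> (x \<in> U \<and> y \<in> U \<and> att x \<subseteq> P \<and> att y \<inter> P = {} \<and>
          \<not> (\<exists>z z'. \<exists>q\<in>U. att x = {z} \<and> att y = {z'} \<and> att q = {z, z'})) \<longrightarrow> card S \<le> 3)"
    proof (cases "x \<in> U \<and> y \<in> U \<and> att x \<subseteq> P \<and> att y \<inter> P = {} \<and>
        (\<exists>z z'. \<exists>q\<in>U. att x = {z} \<and> att y = {z'} \<and> att q = {z, z'})")
      case True
      \<comment> \<open>The route \<open>x\<close>, \<open>z\<close>, component of \<open>q\<close>,
        \<open>z'\<close>, \<open>y\<close> bypasses \<open>s\<close> and uses only two vertices of
        \<open>N\<close>.\<close>
      then obtain z z' q where att: "q \<in> U" "att x = {z}" "att y = {z'}" "att q = {z, z'}"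
        by (elim conjE exE bexE) (rule that)
      have "z \<in> P" "z' \<in> N - P" using True att_N[of y] att by auto
      with True att have z: "x \<in> U" "y \<in> U" "z \<in> P" "z' \<in> N - P" "q \<in> U" "att x = {z}"
        "att y = {z'}" "att q = {z, z'}"
        by simp_all
      have qX: "q \<in> X" using z by (auto simp: X_def mixed_def)
      obtain a v where "(x, a) \<in> rtrancl_on (comp x) D" "a \<in> comp x" "(a, v) \<in> D" "v \<in> att x"
        using leave_comp[OF DR(1) z(1)] Dstrong xy s_B by blast
      then have xz: "(x, z) \<in> rtrancl_on (comp x \<union> {z}) D"
        using z(6) by (auto intro: rtrancl_on_snoc)
      obtain b w where "(y, b) \<in> rtrancl_on (comp y) (D\<inverse>)" "b \<in> comp y" "(b, w) \<in> D\<inverse>" "w \<in> att y"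
        using leave_comp[OF DR(2) z(2)] Dstrong xy s_B by (auto simp: rtrancl_converse)
      then have zy: "(z', y) \<in> rtrancl_on (comp y \<union> {z'}) D"
        using z(7) by (auto simp: rtrancl_on_converse intro: rtrancl_on_Cons)
      obtain c where c: "c \<in> comp q" "(c, z) \<in> R" using z(8) by (auto simp: att_def)
      have cX: "c \<in> X" using mixed_comp qX c by (auto simp: X_def)
      have zc: "(z, c) \<in> D" using facts(3)[OF z(3) cX] c R_sym by blast
      have cU: "c \<in> U" using c comp_U by auto
      then have "(c, s) \<in> D\<^sup>*" using Dstrong s_B by (auto simp: U_def)
      then obtain d u where d: "(c, d) \<in> rtrancl_on (comp c) D" "d \<in> comp c" "(d, u) \<in> D" "u \<in> att c"
        using leave_comp[OF DR(1) cU] by blast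
      have "d \<in> X" using mixed_comp cX d by (auto simp: X_def)
      \<comment> \<open>No arc leads from a mixed vertex to \<open>P\<close>, so the walk can leave
        this component only at \<open>z'\<close>.\<close>
      then have "u \<notin> P" using facts(4) d(3) by blast
      then have "u = z'" using d(4) att_eq[OF c(1)] z(3,8) by auto
      have "(c, z') \<in> rtrancl_on (X \<union> {z'}) D"
        using d(1,3) mixed_comp cX unfolding \<open>u = z'\<close> X_def by (intro rtrancl_on_snoc[OF d(1)]) auto
      then have "(z, z') \<in> rtrancl_on (X \<union> {z, z'}) D"
        by (rule rtrancl_on_Cons[OF zc]) auto
      then have "(x, y) \<in> rtrancl_on (?W \<union> {z, z'}) D"
        by (rule rtrancl_on_join[OF rtrancl_on_join[OF xz _ subset_refl] zy]) auto
      then show ?thesis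
        using z PN by (intro exI[of _ "{z, z'}"]) (auto simp: card_insert_if)
    next
      case False
      obtain S1 where S1: "S1 \<subseteq> N" "(x, s) \<in> rtrancl_on (insert s X \<union> comp x \<union> S1) D" "card S1 \<le> 2"
        "x \<notin> P \<longrightarrow> \<not> (x \<in> U \<and> att x \<subseteq> P) \<longrightarrow> card S1 \<le> 1"
        using leave'[OF xy(1)] by blast
      obtain S2 where S2: "S2 \<subseteq> N" "(s, y) \<in> rtrancl_on (insert s X \<union> comp y \<union> S2) D" "card S2 \<le> 2"
        "y \<notin> N - P \<longrightarrow> \<not> (y \<in> U \<and> att y \<subseteq> N - P) \<longrightarrow> card S2 \<le> 1"
        using arrive'[OF xy(2)] by blast
      have c: "card (S1 \<union> S2) \<le> card S1 + card S2" by (rule card_Un_le)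
      have "(x, y) \<in> rtrancl_on (?W \<union> (S1 \<union> S2)) D"
        by (rule rtrancl_on_join[OF S1(2) S2(2)]) auto
      moreover have "card (S1 \<union> S2) \<le> 4" using c S1(3) S2(3) by linarith
      moreover have "card (S1 \<union> S2) \<le> 3"
        if "x \<notin> N" "y \<notin> N" "\<not> (x \<in> U \<and> y \<in> U \<and> att x \<subseteq> P \<and> att y \<inter> P = {})"
      proof -
        have "card S1 \<le> 1 \<or> card S2 \<le> 1"
          using S1(4) S2(4) that PN by blast
        then show ?thesis using c S1(3) S2(3) by linarith
      qed
      ultimately show ?thesis
        using False S1(1) S2(1) by (rule_tac exI[of _ "S1 \<union> S2"], intro conjI impI) (auto simp only: Un_subset_iff)
    qed
    then show "\<exists>S\<subseteq>N. (x, y) \<in> rtrancl_on (insert s (mixed P) \<union> comp x \<union> comp y \<union> S) D \<and> card S \<le> 4 \<and>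
      (x \<notin> N \<longrightarrow> y \<notin> N \<longrightarrow>
        \<not> (x \<in> U \<and> y \<in> U \<and> att x \<subseteq> P \<and> att y \<inter> P = {} \<and>
          \<not> (\<exists>z z'. \<exists>q\<in>U. att x = {z} \<and> att y = {z'} \<and> att q = {z, z'})) \<longrightarrow> card S \<le> 3)"
      by (simp only: X_def)
  qed
qed

end

text \<open>Four vertices of \<open>N\<close> cost 8, which the bound absorbs as 7 + 1 when an end
  lies in \<open>A\<close>. For two ends in \<open>B\<close>, either three vertices suffice or
  \<open>W\<close> misses a vertex of \<open>A - N\<close>.\<close>

lemma (in bipartite_star) short_orientation:
  obtains D where "orients D R" and "\<And>x y. x \<in> A \<union> B \<Longrightarrow> y \<in> A \<union> B \<Longrightarrow>
    \<exists>W\<subseteq>A \<union> B. (x, y) \<in> rtrancl_on W D \<and>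
      2 * card (W \<inter> A) + 2 * card N \<le> 2 * card A + 7 + of_bool (x \<in> A) + of_bool (y \<in> A)"
proof -
  have finN: "finite N" using N_A finite_AB(1) by (rule finite_subset)
  have "\<exists>P\<subseteq>N. (\<forall>v\<in>N. \<exists>e\<in>att ` U. v \<in> e \<and> e \<inter> P \<noteq> {} \<and> e - P \<noteq> {}) \<and>
    (\<forall>e\<in>att ` U. \<forall>f\<in>att ` U. e \<subseteq> P \<longrightarrow> f \<inter> P = {} \<longrightarrow>
      (\<exists>z z'. e = {z} \<and> f = {z'} \<and> {z, z'} \<in> att ` U) \<or>
      (\<exists>w. {w} \<in> att ` U \<and> {w} \<noteq> e \<and> {w} \<noteq> f))"
  proof (rule bicolouring_exists[OF finN])
    show "{} \<notin> att ` U" using att_nonempty by auto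
    show "\<exists>e\<in>att ` U. v \<in> e \<and> e \<noteq> {v}" if "v \<in> N" for v
      using touches_two[OF that] by (metis imageI)
  qed (use att_N in auto)
  then obtain P where PN: "P \<subseteq> N"
    and cover: "\<forall>v\<in>N. \<exists>e\<in>att ` U. v \<in> e \<and> e \<inter> P \<noteq> {} \<and> e - P \<noteq> {}"
    and critical: "\<forall>e\<in>att ` U. \<forall>f\<in>att ` U. e \<subseteq> P \<longrightarrow> f \<inter> P = {} \<longrightarrow>
      (\<exists>z z'. e = {z} \<and> f = {z'} \<and> {z, z'} \<in> att ` U) \<or>
      (\<exists>w. {w} \<in> att ` U \<and> {w} \<noteq> e \<and> {w} \<noteq> f)"
    by (elim exE conjE) (rule that)
  have valid: "\<exists>q\<in>mixed P. (v, q) \<in> R" if v: "v \<in> N" for v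
  proof -
    obtain q where q: "v \<in> att q" "att q \<inter> P \<noteq> {}" "att q - P \<noteq> {}" using cover v by blast
    then obtain x where x: "x \<in> comp q" "(x, v) \<in> R" by (auto simp: att_def)
    then have "x \<in> mixed P" using q att_eq[OF x(1)] comp_U by (auto simp: mixed_def)
    then show ?thesis using x(2) R_sym by blast
  qed
  obtain D where D: "orients D R" and paths: "\<And>x y. x \<in> A \<union> B \<Longrightarrow> y \<in> A \<union> B \<Longrightarrow>
    \<exists>S\<subseteq>N. (x, y) \<in> rtrancl_on (insert s (mixed P) \<union> comp x \<union> comp y \<union> S) D \<and> card S \<le> 4 \<and>
      (x \<notin> N \<longrightarrow> y \<notin> N \<longrightarrow>
        \<not> (x \<in> U \<and> y \<in> U \<and> att x \<subseteq> P \<and> att y \<inter> P = {} \<and>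
          \<not> (\<exists>z z'. \<exists>q\<in>U. att x = {z} \<and> att y = {z'} \<and> att q = {z, z'})) \<longrightarrow> card S \<le> 3)"
    by (rule partition_orientation[OF PN]) (erule valid, rule that)
  show ?thesis
  proof (rule that[OF D])
    fix x y assume xy: "x \<in> A \<union> B" "y \<in> A \<union> B"
    obtain S where S: "S \<subseteq> N" "card S \<le> 4"
      and path: "(x, y) \<in> rtrancl_on (insert s (mixed P) \<union> comp x \<union> comp y \<union> S) D"
      and S3: "x \<notin> N \<longrightarrow> y \<notin> N \<longrightarrow>
        \<not> (x \<in> U \<and> y \<in> U \<and> att x \<subseteq> P \<and> att y \<inter> P = {} \<and>
          \<not> (\<exists>z z'. \<exists>q\<in>U. att x = {z} \<and> att y = {z'} \<and> att q = {z, z'})) \<longrightarrow> card S \<le> 3"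
      using paths[OF xy] by (elim exE conjE) (rule that)
    define W where "W = insert s (mixed P) \<union> comp x \<union> comp y \<union> S"
    have mU: "mixed P \<subseteq> U" by (auto simp: mixed_def)
    have WV: "W \<subseteq> A \<union> B"
      using mU comp_U[of x] comp_U[of y] S(1) N_A s_B by (auto simp: W_def U_def)
    have "W \<inter> N \<subseteq> S"
      using mU comp_U[of x] comp_U[of y] N_U s_notin by (auto simp: W_def)
    then have WN: "card (W \<inter> N) \<le> card S"
      using S(1) finN by (intro card_mono) (auto intro: finite_subset)
    have "card (W \<inter> A) = card (W \<inter> N) + card (W \<inter> A - N)"
      using N_A finite_AB(1) finN
      by (subst card_Un_disjoint[symmetric]) (auto intro: arg_cong[where f = card])
    moreover have "card A = card N + card (A - N)"
      using N_A finite_AB(1) finN by (simp add: card_Diff_subset card_mono)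
    moreover have "card (W \<inter> A - N) \<le> card (A - N)"
      using finite_AB(1) by (intro card_mono) auto
    moreover have "card S \<le> 3 \<or> card (W \<inter> A - N) < card (A - N)" if "x \<notin> A" "y \<notin> A"
    proof (cases "card S \<le> 3")
      case False
      have "x \<notin> N" "y \<notin> N" using that N_A by auto
      then have bad: "x \<in> U" "y \<in> U" "att x \<subseteq> P" "att y \<inter> P = {}"
        "\<not> (\<exists>z z'. \<exists>q\<in>U. att x = {z} \<and> att y = {z'} \<and> att q = {z, z'})"
        using S3 False by simp_all
      have "att x \<in> att ` U" "att y \<in> att ` U" using bad(1,2) by auto
      then have "(\<exists>z z'. att x = {z} \<and> att y = {z'} \<and> {z, z'} \<in> att ` U) \<or>
        (\<exists>w. {w} \<in> att ` U \<and> {w} \<noteq> att x \<and> {w} \<noteq> att y)"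
        by (rule critical[rule_format, OF _ _ bad(3,4)])
      moreover have "\<not> (\<exists>z z'. att x = {z} \<and> att y = {z'} \<and> {z, z'} \<in> att ` U)"
      proof
        assume "\<exists>z z'. att x = {z} \<and> att y = {z'} \<and> {z, z'} \<in> att ` U"
        then obtain z z' q where "att x = {z}" "att y = {z'}" "q \<in> U" "att q = {z, z'}" by auto
        then show False using bad(5) by blast
      qed
      \<comment> \<open>A component attached only to \<open>w\<close> is neither mixed nor that of
        \<open>x\<close> or \<open>y\<close>, so its vertex \<open>a\<close> of \<open>A\<close> is
        missing from \<open>W\<close>.\<close>
      ultimately obtain w where "{w} \<in> att ` U" and ne: "{w} \<noteq> att x" "{w} \<noteq> att y"
        by (elim disjE exE conjE) (simp, rule that)
      then obtain q where q: "q \<in> U" "att q = {w}" by auto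
      then obtain a where a: "a \<in> comp q" "a \<in> A" using pendant_meets_A by blast
      have "att a = {w}" using att_eq[OF a(1)] q(2) by simp
      moreover have "a \<in> U" using a(1) comp_U by auto
      ultimately have "a \<notin> comp x" "a \<notin> comp y" "a \<notin> mixed P" "a \<noteq> s" "a \<notin> N"
        using ne att_eq[of a x] att_eq[of a y] s_notin N_U by (auto simp: mixed_def)
      then have "a \<notin> W" "a \<in> A - N" using S(1) a(2) by (auto simp: W_def)
      then have "W \<inter> A - N \<subset> A - N" by blast
      then show ?thesis using finite_AB(1) by (auto intro: psubset_card_mono)
    qed simp
    ultimately have "2 * card (W \<inter> A) + 2 * card N \<le> 2 * card A + 7 + of_bool (x \<in> A) + of_bool (y \<in> A)"
      using WN S(2) by (cases "x \<in> A"; cases "y \<in> A") auto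
    then show "\<exists>W\<subseteq>A \<union> B. (x, y) \<in> rtrancl_on W D \<and>
      2 * card (W \<inter> A) + 2 * card N \<le> 2 * card A + 7 + of_bool (x \<in> A) + of_bool (y \<in> A)"
      using WV path unfolding W_def by blast
  qed
qed

lemma (in mixed_graph) oriented_diam_undirected:
  assumes br: "bridgeless G" and bip: "mixed_bipartite G A B" "card A = card B" and s: "s \<in> B"
    and und: "marcs G = {}"
  shows "oriented_diam G + enat (2 * undirected_degree G s) \<le> enat (card (mverts G) + 7)"
proof -
  have AB: "A \<inter> B = {}" "A \<union> B = mverts G" using bip by (simp_all add: mixed_bipartite_def)
  then have n: "card (mverts G) = 2 * card A"
    using bip(2) finite_mverts by (metis card_Un_disjoint finite_Un mult_2)
  have conn: "mixed_connected G" using br by (simp add: bridgeless_def)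
  have sym: "sym (traversal G)" using und by (auto simp: sym_def traversal_def insert_commute)
  then have conv: "traversal G \<union> (traversal G)\<inverse> = traversal G" by (simp add: sym_conv_converse_eq)
  interpret bipartite_star A B "traversal G" s
  proof
    show "finite A" "finite B" using AB(2) finite_mverts by (metis finite_Un)+
    show "traversal G \<subseteq> A \<times> B \<union> B \<times> A"
      using bip(1) unfolding mixed_bipartite_def traversal_def by (fastforce simp: doubleton_eq_iff)
    show "(x, y) \<in> (traversal G)\<^sup>*" if "x \<in> A \<union> B" "y \<in> A \<union> B" for x y
      using mixed_connected_traversal[OF conn] that AB(2) by blast
    show "(x, y) \<in> (traversal G - {(x, y), (y, x)})\<^sup>*" if "(x, y) \<in> traversal G" for x y
      using bridgeless_traversal[OF br, of x y] that und unfolding conv by (simp add: traversal_def)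
  qed (use AB sym s in auto)
  have N: "N = {v. {s, v} \<in> medges G}" unfolding N_def using und by (auto simp: traversal_def)
  obtain D where D: "orients D (traversal G)" and W: "\<And>x y. x \<in> A \<union> B \<Longrightarrow> y \<in> A \<union> B \<Longrightarrow>
    \<exists>W\<subseteq>A \<union> B. (x, y) \<in> rtrancl_on W D \<and>
      2 * card (W \<inter> A) + 2 * card N \<le> 2 * card A + 7 + of_bool (x \<in> A) + of_bool (y \<in> A)"
    by (rule short_orientation) (rule that)
  show ?thesis
    by (rule oriented_diam_le[OF bip(1) D], unfold card_neighbours n, fold N AB(2), rule W)
qed

section \<open>The choice of the central vertex and of its side\<close>

lemma mixed_bipartite_commute: "mixed_bipartite G A B \<longleftrightarrow> mixed_bipartite G B A"
proof -
  have "(\<exists>a\<in>A. \<exists>b\<in>B. e = {a, b}) \<longleftrightarrow> (\<exists>a\<in>B. \<exists>b\<in>A. e = {a, b})" for e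
    by (metis insert_commute)
  then show ?thesis
    unfolding mixed_bipartite_def by (simp add: Int_commute Un_commute)
qed

theorem corollary1p6:
  fixes G :: "'a mixed_graph" and n \<Delta> :: nat
  assumes "mixed_graph G"
    and "equal_partition_bipartite G"
    and "bridgeless G"
    and "n = card (mverts G)"
    and "\<Delta> = max_undirected_degree G"
  shows "(marcs G = {} \<longrightarrow> oriented_diam G + enat (2 * \<Delta>) \<le> enat (n + 7)) \<and>
    ((\<exists>u\<in>mverts G. undirected_degree G u = \<Delta> \<and> arc_out_degree G u + arc_in_degree G u \<ge> 2) \<longrightarrow>
      oriented_diam G + enat (2 * \<Delta>) \<le> enat (n + 8)) \<and>
    (marcs G \<noteq> {} \<and>
     \<not> (\<exists>u\<in>mverts G. undirected_degree G u = \<Delta> \<and> arc_out_degree G u + arc_in_degree G u \<ge> 2) \<longrightarrow>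
      oriented_diam G + enat (2 * \<Delta>) \<le> enat (n + 10))"
proof -
  interpret mixed_graph G by fact
  \<comment> \<open>The partite sets are interchangeable, so a chosen vertex may be assumed to lie
    in the second one.\<close>
  have side: "\<exists>A B. mixed_bipartite G A B \<and> card A = card B \<and> u \<in> B" if u: "u \<in> mverts G" for u
  proof -
    obtain A B where AB: "mixed_bipartite G A B" "card A = card B"
      using assms(2) unfolding equal_partition_bipartite_def by blast
    then have "u \<in> A \<or> u \<in> B" using u by (auto simp: mixed_bipartite_def)
    then show ?thesis using AB mixed_bipartite_commute by metis
  qed
  have "\<Delta> \<in> undirected_degree G ` mverts G"
    unfolding assms(5) max_undirected_degree_def
    using finite_mverts mverts_nonempty by (intro Max_in) auto
  then obtain u where u: "u \<in> mverts G" "undirected_degree G u = \<Delta>" by auto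
  obtain A B where AB: "mixed_bipartite G A B" "card A = card B" "u \<in> B" using side[OF u(1)] by blast
  show ?thesis
  proof (intro conjI impI)
    assume "marcs G = {}"
    then show "oriented_diam G + enat (2 * \<Delta>) \<le> enat (n + 7)"
      using oriented_diam_undirected[OF assms(3) AB] u(2) assms(4) by simp
  next
    assume "\<exists>u\<in>mverts G. undirected_degree G u = \<Delta> \<and> arc_out_degree G u + arc_in_degree G u \<ge> 2"
    then obtain w where w: "w \<in> mverts G" "undirected_degree G w = \<Delta>"
      "arc_out_degree G w + arc_in_degree G w \<ge> 2" by blast
    obtain C E where "mixed_bipartite G C E" "card C = card E" "w \<in> E" using side[OF w(1)] by blast
    from oriented_diam_mixed(2)[OF assms(3) this w(3)]
    show "oriented_diam G + enat (2 * \<Delta>) \<le> enat (n + 8)" using w(2) assms(4) by simp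
  next
    show "oriented_diam G + enat (2 * \<Delta>) \<le> enat (n + 10)"
      using oriented_diam_mixed(1)[OF assms(3) AB] u(2) assms(4) by simp
  qed
qed

end
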